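(* For any real $\alpha>1$ there exists a constant $c_\alpha$, depending only on $\alpha$, such that for all integers $r\ge1$, all integers $n\ge 1$ and all $f\in C$, $$E_{n-1}(f)\le c_\alpha\,\gamma_r^*\,\omega_r\left(f,\frac{\alpha\pi}{n}\right).$$
   Context: $C$ is the space of continuous $2\pi$-periodic functions $f$ on $\mathbb{R}$ with the uniform norm $\|f\|$. $T_{n-1}$ is the space of trigonometric polynomials of degree $\le n-1$, and $E_{n-1}(f)=\inf_{\tau\in T_{n-1}}\|f-\tau\|$. The $r$-th modulus of smoothness is $\omega_r(f,\delta)=\sup_{0<h\le\delta}\|\Delta_h^r(f,\cdot)\|$, where $\Delta_h^r(f,x)=\sum_{i=0}^r(-1)^i\binom{r}{i}f(x+ih)$. Also $\gamma_r^*=\binom{r}{\lfloor r/2\rfloor}^{-1}$. *)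

theory Defs
  imports "HOL-Analysis.Analysis"
begin

definition C_per :: "(real \<Rightarrow> real) set" where
  "C_per = {f. continuous_on UNIV f \<and> (\<forall>x. f (x + 2 * pi) = f x)}"

(* Real suprema and infima in HOL are meaningful only for nonempty bounded sets.
   This is the case in all uses below when f lies in C_per and \<delta> > 0:
   f is then bounded, hence so are f - \<tau> and all differences of f, and the
   values of uniform_norm are nonnegative and uniformly bounded in h. *)
definition uniform_norm :: "(real \<Rightarrow> real) \<Rightarrow> real" where
  "uniform_norm f = (SUP x. \<bar>f x\<bar>)"

definition trig_polys :: "nat \<Rightarrow> (real \<Rightarrow> real) set" where
  "trig_polys m = {\<tau>. \<exists>(a :: nat \<Rightarrow> real) (b :: nat \<Rightarrow> real). \<forall>x.
     \<tau> x = a 0 + (\<Sum>k = 1..m. a k * cos (real k * x) + b k * sin (real k * x))}"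

definition best_approx :: "nat \<Rightarrow> (real \<Rightarrow> real) \<Rightarrow> real" where
  "best_approx m f = (INF \<tau>\<in>trig_polys m. uniform_norm (\<lambda>x. f x - \<tau> x))"

definition fin_diff :: "nat \<Rightarrow> real \<Rightarrow> (real \<Rightarrow> real) \<Rightarrow> real \<Rightarrow> real" where
  "fin_diff r h f x = (\<Sum>i = 0..r. (- 1) ^ i * real (r choose i) * f (x + real i * h))"

definition mod_smooth :: "nat \<Rightarrow> (real \<Rightarrow> real) \<Rightarrow> real \<Rightarrow> real" where
  "mod_smooth r f \<delta> = (SUP h\<in>{0<..\<delta>}. uniform_norm (fin_diff r h f))"

definition gamma_star :: "nat \<Rightarrow> real" where
  "gamma_star r = inverse (real (r choose (r div 2)))"

end

theory Submission
  imports Defs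
begin

text \<open>
  Let \<open>r = 2 k\<close> be even, \<open>h = \<alpha> pi / n\<close> and \<open>\<gamma> = gamma_star r\<close>. The centred difference of order \<open>r\<close>
  and step \<open>t\<close>, times \<open>(- 1) ^ k \<gamma>\<close>, multiplies a wave of frequency \<open>j\<close> by \<open>P (j t)\<close> with the kernel
  \<open>P s = \<gamma> (2 sin (s / 2)) ^ (2 k)\<close>. Averaging over \<open>t\<close> in \<open>{0..h}\<close> with the probability density
  \<open>3 (h - t)\<^sup>2 / h\<^sup>3\<close> gives an operator whose value on \<open>f\<close> is bounded by \<open>\<gamma> \<omega>\<close>, where \<open>\<omega>\<close> is the modulus
  of smoothness, and which multiplies the frequency \<open>j\<close> by a number \<open>M (j h)\<close>. If \<open>M (j h)\<close> can be
  inverted for \<open>j \<ge> n\<close> by a multiplier of bounded norm, then \<open>f\<close> is recovered from its averaged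
  difference up to a trigonometric polynomial of degree below \<open>n\<close>, with an error of the size
  \<open>\<gamma> \<omega>\<close>. What has to be shown is that the norm of the inverse is bounded independently of \<open>k\<close> and
  \<open>n\<close>.

  Independence of \<open>k\<close> has a simple reason. The kernel is nonnegative, and its integral over
  \<open>{0..m pi}\<close> is exactly \<open>m pi\<close>; hence its antiderivative \<open>J1\<close> satisfies \<open>\<bar>J1 s - s\<bar> \<le> pi\<close> for every \<open>k\<close>
  (\<open>J1_near_identity\<close>). Since \<open>M y = 6 J3 y / y\<^sup>3\<close> with the third antiderivative \<open>J3\<close>, this one
  inequality yields \<open>M y \<ge> (1 - pi / y)\<^sup>3\<close> (\<open>M_lower\<close>), which is bounded away from zero for
  \<open>y \<ge> \<alpha> pi\<close> because \<open>\<alpha> > 1\<close>, and it shows that the first two derivatives of \<open>M\<close> decay like \<open>1 / y\<^sup>2\<close>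
  and \<open>1 / y\<^sup>3\<close>.

  The norm of a multiplier is estimated without Fourier analysis on the line: summation by parts,
  done twice, writes a multiplier sequence \<open>\<kappa>\<close> as a combination of Fejer means with coefficients
  \<open>(l + 1) (\<kappa> l - 2 \<kappa> (l + 1) + \<kappa> (l + 2))\<close>, and Fejer means are contractions (\<open>trig_multiplier_bound\<close>).
  For \<open>\<kappa> j = 1 / M (j h)\<close>, frozen at its value at \<open>n\<close> for \<open>j < n\<close>, the decay of the derivatives makes
  the sum of these coefficients bounded (\<open>inverse_multiplier_bound\<close>).

  To keep all sums finite the argument is carried out for trigonometric sums of arbitrary degree
  (\<open>trig_sum_jackson\<close>) and then extended by density (\<open>C_per_trig_sum_dense\<close>, \<open>jackson_even\<close>). For odd
  \<open>r\<close> one passes to the order \<open>r + 1\<close>, at which the modulus at most doubles while \<open>gamma_star\<close> is halved.\<close>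

section \<open>Trigonometric sums\<close>

definition trig_sum :: "nat \<Rightarrow> (nat \<Rightarrow> complex) \<Rightarrow> real \<Rightarrow> real" where
  "trig_sum N c x = (\<Sum>j\<le>N. Re (c j * cis (real j * x)))"

lemma trig_sum_in_trig_polys: "trig_sum N c \<in> trig_polys N"
proof -
  have "trig_sum N c x = Re (c 0) + (\<Sum>k = 1..N. Re (c k) * cos (real k * x) + (- Im (c k)) * sin (real k * x))" for x
    unfolding trig_sum_def atMost_atLeast0 by (subst sum.atLeast_Suc_atMost) auto
  then show ?thesis
    unfolding trig_polys_def by (intro CollectI exI[of _ "\<lambda>k. Re (c k)"] exI[of _ "\<lambda>k. - Im (c k)"]) simp
qed

lemma trig_sum_diff: "trig_sum N c x - trig_sum N d x = trig_sum N (\<lambda>j. c j - d j) x"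
  by (simp add: trig_sum_def left_diff_distrib flip: sum_subtractf)

lemma trig_sum_sum: "(\<Sum>i\<in>I. trig_sum N (c i) x) = trig_sum N (\<lambda>j. \<Sum>i\<in>I. c i j) x"
  unfolding trig_sum_def by (subst sum.swap) (simp add: sum_distrib_right Re_sum)

lemma trig_sum_scale: "r * trig_sum N c x = trig_sum N (\<lambda>j. of_real r * c j) x"
  by (simp add: trig_sum_def sum_distrib_left algebra_simps)

lemma trig_sum_supported:
  assumes "\<And>j. j > m \<Longrightarrow> j \<le> N \<Longrightarrow> c j = 0"
  shows "trig_sum N c \<in> trig_polys m"
proof -
  have "trig_sum N c = trig_sum m (\<lambda>j. if j \<le> N then c j else 0)"
  proof
    fix x
    have "trig_sum N c x = (\<Sum>j\<in>{..N} \<inter> {..m}. Re (c j * cis (real j * x)))"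
      unfolding trig_sum_def
    proof (rule sum.mono_neutral_right)
      show "\<forall>j\<in>{..N} - {..N} \<inter> {..m}. Re (c j * cis (real j * x)) = 0"
      proof
        fix j assume "j \<in> {..N} - {..N} \<inter> {..m}"
        then have "c j = 0" by (intro assms) auto
        then show "Re (c j * cis (real j * x)) = 0" by simp
      qed
    qed auto
    also have "\<dots> = (\<Sum>j\<in>{..N} \<inter> {..m}. Re ((if j \<le> N then c j else 0) * cis (real j * x)))"
      by (intro sum.cong) auto
    also have "\<dots> = trig_sum m (\<lambda>j. if j \<le> N then c j else 0) x"
      unfolding trig_sum_def by (intro sum.mono_neutral_left) auto
    finally show "trig_sum N c x = trig_sum m (\<lambda>j. if j \<le> N then c j else 0) x" .
  qed
  then show ?thesis using trig_sum_in_trig_polys by simp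
qed

section \<open>Fejer means at equally spaced nodes\<close>

text \<open>The square of a Dirichlet-type sum exhibits the positivity of the Fejer kernel, and its
  expansion as a double sum contains all Fourier coefficients that are needed below.\<close>

definition fejer :: "nat \<Rightarrow> real \<Rightarrow> real" where
  "fejer m t = (cmod (\<Sum>p<m. cis (real p * t)))\<^sup>2 / real m"

lemma fejer_nonneg: "fejer m t \<ge> 0"
  by (simp add: fejer_def)

lemma fejer_eq_double_sum:
  "complex_of_real (fejer m t) = (\<Sum>p<m. \<Sum>q<m. cis ((real p - real q) * t)) / of_nat m"
proof -
  have "complex_of_real ((cmod (\<Sum>p<m. cis (real p * t)))\<^sup>2)
      = (\<Sum>p<m. cis (real p * t)) * cnj (\<Sum>p<m. cis (real p * t))"
    by (rule complex_norm_square)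
  also have "\<dots> = (\<Sum>p<m. \<Sum>q<m. cis ((real p - real q) * t))"
    by (simp add: sum_product cis_cnj cis_mult algebra_simps)
  finally show ?thesis by (simp add: fejer_def)
qed

text \<open>Equally spaced nodes integrate exponentials of frequency below \<open>L\<close> exactly. Hence sums over
  nodes can replace integrals over a period throughout.\<close>

lemma sum_cis_nodes:
  fixes d :: int
  assumes "L > 0" "\<bar>d\<bar> < int L"
  shows "(\<Sum>l<L. cis (of_int d * (x - 2 * pi * real l / real L))) = (if d = 0 then of_nat L else 0)"
proof (cases "d = 0")
  case False
  define z where "z = cis (- (2 * pi * of_int d / real L))"
  have "z \<noteq> 1"
  proof
    assume "z = 1"
    then have "cos (2 * pi * of_int d / real L) = 1"
      by (simp add: z_def complex_eq_iff)
    then obtain k :: int where "2 * pi * of_int d / real L = of_int k * 2 * pi"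
      using cos_one_2pi_int by blast
    then have "real_of_int d = of_int k * real L"
      using assms(1) by (simp add: field_simps)
    then have "d = k * int L" by (metis of_int_eq_iff of_int_mult of_int_of_nat_eq)
    with assms False show False
      by (metis dvd_triv_right zdvd_imp_le abs_of_nat dvd_abs_iff zero_less_abs_iff not_le)
  qed
  moreover have "z ^ L = 1"
  proof -
    have "z ^ L = cis (2 * pi * of_int (- d))"
      using assms(1) unfolding z_def Complex.DeMoivre by (intro arg_cong[of _ _ cis]) simp
    also have "\<dots> = 1" by (rule cis_multiple_2pi) auto
    finally show ?thesis .
  qed
  ultimately have "(\<Sum>l<L. z ^ l) = 0" by (simp add: geometric_sum)
  moreover have "cis (of_int d * (x - 2 * pi * real l / real L)) = cis (of_int d * x) * z ^ l" for l
    by (simp add: z_def Complex.DeMoivre cis_mult algebra_simps)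
  ultimately show ?thesis using False by (simp flip: sum_distrib_left)
qed simp

text \<open>Orthogonality leaves those pairs \<open>(p, q)\<close> with \<open>p = q + j\<close>, and there are \<open>m - j\<close> of them.\<close>

lemma fejer_moment:
  assumes "m > 0" "L \<ge> m + j"
  shows "(\<Sum>l<L. of_real (fejer m (x - 2 * pi * real l / real L)) * cis (- (real j * (x - 2 * pi * real l / real L))))
       = of_real (real L * max 0 (1 - real j / real m))"
    (is "?S = _")
proof -
  let ?u = "\<lambda>l. x - 2 * pi * real l / real L"
  have *: "(\<Sum>l<L. cis ((real p - real q - real j) * ?u l)) = (if p = q + j then of_nat L else 0)"
    if "p < m" "q < m" for p q
    using sum_cis_nodes[of L "int p - int q - int j" x] assms that by auto
  have F: "of_nat m * (of_real (fejer m t) * cis (- (real j * t))) = (\<Sum>p<m. \<Sum>q<m. cis ((real p - real q - real j) * t))" for t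
  proof -
    have "of_nat m * (of_real (fejer m t) * cis (- (real j * t)))
        = (\<Sum>p<m. \<Sum>q<m. cis ((real p - real q) * t)) * cis (- (real j * t))"
      using assms(1) by (simp add: fejer_eq_double_sum)
    also have "\<dots> = (\<Sum>p<m. \<Sum>q<m. cis ((real p - real q - real j) * t))"
      by (simp add: sum_distrib_right cis_mult left_diff_distrib)
    finally show ?thesis .
  qed
  have "of_nat m * ?S = (\<Sum>l<L. \<Sum>p<m. \<Sum>q<m. cis ((real p - real q - real j) * ?u l))"
    unfolding sum_distrib_left F ..
  also have "\<dots> = (\<Sum>p<m. \<Sum>q<m. \<Sum>l<L. cis ((real p - real q - real j) * ?u l))"
    by (subst sum.swap, rule sum.cong[OF refl], rule sum.swap)
  also have "\<dots> = (\<Sum>p<m. \<Sum>q<m. if p = q + j then of_nat L else 0)"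
    using * by (intro sum.cong) auto
  also have "\<dots> = (\<Sum>q<m. \<Sum>p<m. if p = q + j then of_nat L else 0)"
    by (rule sum.swap)
  also have "\<dots> = (\<Sum>q<m. if q + j < m then of_nat L else 0)"
    by simp
  also have "\<dots> = of_nat ((m - j) * L)"
  proof -
    have "{q. q < m \<and> q + j < m} = {..<m - j}" by auto
    then show ?thesis by (simp flip: sum.inter_filter)
  qed
  also have "\<dots> = of_nat m * of_real (real L * max 0 (1 - real j / real m))"
  proof -
    have "real ((m - j) * L) = real m * (real L * max 0 (1 - real j / real m))"
      using assms(1) by (cases "j \<le> m") (auto simp: max_def field_simps of_nat_diff)
    then show ?thesis by (metis of_real_mult of_real_of_nat_eq)
  qed
  finally show ?thesis using assms(1) by simp
qed

text \<open>One operator serves two purposes. On trigonometric sums it acts as the Fejer mean, provided that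
  there are enough nodes; for arbitrary data \<open>v\<close> it produces a trigonometric polynomial in \<open>x\<close>.\<close>

definition fejer_interp :: "nat \<Rightarrow> nat \<Rightarrow> (real \<Rightarrow> real) \<Rightarrow> real \<Rightarrow> real" where
  "fejer_interp m L v x =
     (\<Sum>l<L. fejer m (x - 2 * pi * real l / real L) * v (2 * pi * real l / real L)) / real L"

lemma sum_fejer_nodes:
  assumes "m > 0" "L \<ge> m"
  shows "(\<Sum>l<L. fejer m (x - 2 * pi * real l / real L)) = real L"
proof -
  have "complex_of_real (\<Sum>l<L. fejer m (x - 2 * pi * real l / real L)) = of_real (real L)"
    using fejer_moment[of m 0 L x] assms by simp
  then show ?thesis by (simp only: of_real_eq_iff)
qed

lemma abs_fejer_interp_le:
  assumes bound: "\<And>y. \<bar>v y\<bar> \<le> w (x - y)"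
  shows "\<bar>fejer_interp m L v x\<bar> \<le>
    (\<Sum>l<L. fejer m (x - 2 * pi * real l / real L) * w (x - 2 * pi * real l / real L)) / real L"
proof -
  have "\<bar>\<Sum>l<L. fejer m (x - 2 * pi * real l / real L) * v (2 * pi * real l / real L)\<bar>
     \<le> (\<Sum>l<L. fejer m (x - 2 * pi * real l / real L) * w (x - 2 * pi * real l / real L))"
    by (intro order_trans[OF sum_abs] sum_mono)
      (simp add: abs_mult fejer_nonneg bound mult_left_mono)
  then show ?thesis by (simp add: fejer_interp_def divide_right_mono)
qed

lemma fejer_interp_trig_sum:
  assumes "m > 0" "L \<ge> m + N"
  shows "fejer_interp m L (trig_sum N c) x = trig_sum N (\<lambda>j. of_real (max 0 (1 - real j / real m)) * c j) x"
proof -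
  let ?t = "\<lambda>l. 2 * pi * real l / real L"
  have L: "L > 0" using assms by simp
  have mode: "(\<Sum>l<L. fejer m (x - ?t l) * Re (c j * cis (real j * ?t l)))
      = real L * Re (of_real (max 0 (1 - real j / real m)) * c j * cis (real j * x))"
    if "j \<le> N" for j
  proof -
    have "(\<Sum>l<L. fejer m (x - ?t l) * Re (c j * cis (real j * ?t l)))
       = Re (\<Sum>l<L. of_real (fejer m (x - ?t l)) * (c j * cis (real j * ?t l)))"
      by (simp add: Re_sum)
    also have "(\<Sum>l<L. of_real (fejer m (x - ?t l)) * (c j * cis (real j * ?t l)))
       = (\<Sum>l<L. (c j * cis (real j * x)) * (of_real (fejer m (x - ?t l)) * cis (- (real j * (x - ?t l)))))"
      by (intro sum.cong refl) (simp add: cis_mult algebra_simps)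
    also have "\<dots> = (c j * cis (real j * x)) * of_real (real L * max 0 (1 - real j / real m))"
      using fejer_moment[of m j L x] assms that by (simp only: sum_distrib_left[symmetric])
    finally show ?thesis by (simp add: algebra_simps)
  qed
  have "real L * fejer_interp m L (trig_sum N c) x
      = (\<Sum>l<L. \<Sum>j\<le>N. fejer m (x - ?t l) * Re (c j * cis (real j * ?t l)))"
    using L unfolding fejer_interp_def trig_sum_def sum_distrib_left[symmetric] by simp
  also have "\<dots> = (\<Sum>j\<le>N. \<Sum>l<L. fejer m (x - ?t l) * Re (c j * cis (real j * ?t l)))"
    by (rule sum.swap)
  also have "\<dots> = real L * trig_sum N (\<lambda>j. of_real (max 0 (1 - real j / real m)) * c j) x"
    by (simp only: trig_sum_def sum_distrib_left) (intro sum.cong refl, simp only: mode atMost_iff)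
  finally show ?thesis using L by simp
qed

text \<open>The Fejer mean is an average with nonnegative weights of total mass one, so it cannot increase a
  uniform bound.\<close>

lemma fejer_multiplier_bound:
  assumes "m > 0" and "\<And>x. \<bar>trig_sum N c x\<bar> \<le> B"
  shows "\<bar>trig_sum N (\<lambda>j. of_real (max 0 (1 - real j / real m)) * c j) x\<bar> \<le> B"
proof -
  have "\<bar>fejer_interp m (m + N) (trig_sum N c) x\<bar>
     \<le> (\<Sum>l<m + N. fejer m (x - 2 * pi * real l / real (m + N)) * B) / real (m + N)"
    using assms by (intro abs_fejer_interp_le) auto
  also have "\<dots> = B"
    using sum_fejer_nodes[of m "m + N" x] assms by (simp flip: sum_distrib_right)
  finally show ?thesis using fejer_interp_trig_sum[of m N "m + N" c x] assms by simp
qed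

lemma fejer_interp_is_trig_sum: "\<exists>c. fejer_interp m L v = trig_sum m c"
proof -
  define mode where "mode d t = (\<lambda>j. if j = nat \<bar>d\<bar> then cis (- (real (nat \<bar>d\<bar>) * t)) else 0)" for d :: int and t :: real
  have mode: "cos (of_int d * (x - t)) = trig_sum m (mode d t) x" if "\<bar>d\<bar> \<le> int m" for d t x
  proof -
    have "trig_sum m (mode d t) x = (\<Sum>j\<in>{nat \<bar>d\<bar>}. Re (mode d t j * cis (real j * x)))"
      unfolding trig_sum_def using that by (intro sum.mono_neutral_right) (auto simp: mode_def)
    also have "\<dots> = cos (\<bar>of_int d\<bar> * (x - t))"
      by (simp add: mode_def cis_mult algebra_simps)
    also have "\<dots> = cos (of_int d * (x - t))"
      by (cases "d \<ge> 0") (simp_all add: cos_minus[of "of_int d * (x - t)", symmetric] del: cos_minus)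
    finally show ?thesis by simp
  qed
  have F: "fejer m (x - t) = (1 / real m) * (\<Sum>p<m. \<Sum>q<m. trig_sum m (mode (int p - int q) t) x)" for x t
  proof -
    have "fejer m (x - t) = Re (complex_of_real (fejer m (x - t)))" by simp
    also have "\<dots> = (\<Sum>p<m. \<Sum>q<m. cos ((real p - real q) * (x - t))) / real m"
      unfolding fejer_eq_double_sum by (simp add: Re_sum Re_divide_of_nat)
    also have "\<dots> = (1 / real m) * (\<Sum>p<m. \<Sum>q<m. trig_sum m (mode (int p - int q) t) x)"
      by (simp add: mode[symmetric])
    finally show ?thesis .
  qed
  have "fejer_interp m L v x = (1 / real L) * (\<Sum>l<L. v (2 * pi * real l / real L) * fejer m (x - 2 * pi * real l / real L))" for x
    by (simp add: fejer_interp_def mult.commute)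
  then show ?thesis
    unfolding F trig_sum_scale trig_sum_sum by (intro exI ext)
qed

text \<open>The test function \<open>1 - cos\<close> measures, in the manner of Korovkin, how the mass of the Fejer kernel
  concentrates at \<open>0\<close>.\<close>

lemma sum_fejer_nodes_cos:
  assumes "m > 0" "L \<ge> m + 1"
  shows "(\<Sum>l<L. fejer m (x - 2 * pi * real l / real L) * (1 - cos (x - 2 * pi * real l / real L))) = real L / real m"
proof -
  let ?u = "\<lambda>l. x - 2 * pi * real l / real L"
  have "(\<Sum>l<L. fejer m (?u l) * cos (?u l)) = Re (\<Sum>l<L. of_real (fejer m (?u l)) * cis (- (real 1 * ?u l)))"
    by (simp add: Re_sum del: minus_diff_eq)
  also have "\<dots> = real L * (1 - 1 / real m)"
    unfolding fejer_moment[OF assms] using assms(1) by (simp add: max_def field_simps)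
  finally show ?thesis
    using sum_fejer_nodes[of m L x] assms by (simp add: right_diff_distrib sum_subtractf)
qed

section \<open>Uniform approximation of periodic functions\<close>

lemma C_per_shift_int:
  assumes "f \<in> C_per"
  shows "f (x + 2 * pi * of_int k) = f x"
proof -
  interpret periodic_fun_simple f "2 * pi"
    using assms by unfold_locales (auto simp: C_per_def)
  show ?thesis using plus_of_int[of x k] by (simp add: mult.commute)
qed

lemma reduce_mod_2pi:
  fixes a x :: real
  obtains k :: int where "a \<le> x + 2 * pi * of_int k" "x + 2 * pi * of_int k < a + 2 * pi"
proof
  define k where "k = - \<lfloor>(x - a) / (2 * pi)\<rfloor>"
  have "of_int \<lfloor>(x - a) / (2 * pi)\<rfloor> \<le> (x - a) / (2 * pi)"
    by linarith
  then have "of_int \<lfloor>(x - a) / (2 * pi)\<rfloor> * (2 * pi) \<le> x - a"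
    by (subst (asm) pos_le_divide_eq) auto
  moreover have "(x - a) / (2 * pi) < of_int \<lfloor>(x - a) / (2 * pi)\<rfloor> + 1"
    by linarith
  then have "x - a < (of_int \<lfloor>(x - a) / (2 * pi)\<rfloor> + 1) * (2 * pi)"
    by (subst (asm) pos_divide_less_eq) auto
  ultimately show "a \<le> x + 2 * pi * of_int k" "x + 2 * pi * of_int k < a + 2 * pi"
    by (simp_all add: k_def algebra_simps)
qed

lemma C_per_bounded:
  assumes "f \<in> C_per"
  obtains B where "\<And>x. \<bar>f x\<bar> \<le> B" 
proof -
  have "continuous_on {0..2 * pi} f"
    using assms by (auto simp: C_per_def intro: continuous_on_subset)
  then have "bounded (f ` {0..2 * pi})"
    by (intro compact_imp_bounded compact_continuous_image) auto
  then obtain B where B: "\<And>x. x \<in> {0..2 * pi} \<Longrightarrow> \<bar>f x\<bar> \<le> B"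
    unfolding bounded_iff real_norm_def by blast
  have "\<bar>f x\<bar> \<le> B" for x
  proof -
    obtain k :: int where "0 \<le> x + 2 * pi * of_int k" "x + 2 * pi * of_int k < 0 + 2 * pi"
      using reduce_mod_2pi .
    then show ?thesis using B[of "x + 2 * pi * of_int k"] C_per_shift_int[OF assms, of x k] by simp
  qed
  then show ?thesis by (rule that)
qed

text \<open>Near the diagonal (modulo the period) uniform continuity gives \<open>\<epsilon>\<close>; away from it \<open>1 - cos\<close>
  is bounded below, and a large multiple of it exceeds the total oscillation of \<open>f\<close>.\<close>

lemma C_per_modulus:
  assumes "f \<in> C_per" "\<epsilon> > 0"
  obtains K where "\<And>x y. \<bar>f x - f y\<bar> \<le> \<epsilon> + K * (1 - cos (x - y))"
proof -
  obtain B where B: "\<bar>f x\<bar> \<le> B" for x using C_per_bounded[OF assms(1)] by blast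
  have "continuous_on {- pi..3 * pi} f"
    using assms by (auto simp: C_per_def intro: continuous_on_subset)
  then have "uniformly_continuous_on {- pi..3 * pi} f"
    by (intro compact_uniformly_continuous) auto
  then obtain d where d: "d > 0" "\<And>x y. x \<in> {- pi..3 * pi} \<Longrightarrow> y \<in> {- pi..3 * pi} \<Longrightarrow> \<bar>x - y\<bar> < d \<Longrightarrow> \<bar>f x - f y\<bar> < \<epsilon>"
    using assms(2) unfolding uniformly_continuous_on_def dist_real_def by metis
  define \<delta> where "\<delta> = min d pi"
  have \<delta>: "\<delta> > 0" "\<delta> \<le> pi" "\<delta> \<le> d" using d by (auto simp: \<delta>_def)
  have cos\<delta>: "cos \<delta> < 1" using cos_monotone_0_pi[of 0 \<delta>] \<delta> by simp
  define K where "K = 2 * B / (1 - cos \<delta>)"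
  have "B \<ge> 0" using B[of 0] by linarith
  then have "K \<ge> 0" using cos\<delta> by (simp add: K_def)
  have "\<bar>f x - f y\<bar> \<le> \<epsilon> + K * (1 - cos (x - y))" for x y
  proof -
    \<comment> \<open>Both points are moved by multiples of the period so that they lie at most pi apart.\<close>
    obtain k :: int where k: "0 \<le> y + 2 * pi * of_int k" "y + 2 * pi * of_int k < 0 + 2 * pi"
      using reduce_mod_2pi .
    define y' where "y' = y + 2 * pi * of_int k"
    obtain l :: int where l: "y' - pi \<le> x + 2 * pi * of_int l" "x + 2 * pi * of_int l < y' - pi + 2 * pi"
      using reduce_mod_2pi .
    define x' where "x' = x + 2 * pi * of_int l"
    have f: "f x' = f x" "f y' = f y" by (simp_all add: x'_def y'_def C_per_shift_int[OF assms(1)])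
    have "cos (x' - y') = cos (x - y + of_int (l - k) * (2 * pi))"
      by (simp add: x'_def y'_def algebra_simps)
    also have "\<dots> = cos (x - y)"
      using cos.plus_of_int[of "x - y" "l - k"] by (simp add: mult.commute)
    finally have c: "cos \<bar>x' - y'\<bar> = cos (x - y)" by simp
    show ?thesis
    proof (cases "\<bar>x' - y'\<bar> < d")
      case True
      then have "\<bar>f x' - f y'\<bar> < \<epsilon>"
        using k l by (intro d) (auto simp: x'_def y'_def)
      moreover have "0 \<le> K * (1 - cos (x - y))" using \<open>K \<ge> 0\<close> by simp
      ultimately show ?thesis unfolding f by linarith
    next
      case False
      then have "cos \<bar>x' - y'\<bar> \<le> cos \<delta>"
        using \<delta> l by (intro cos_monotone_0_pi_le) (auto simp: x'_def)
      then have "K * (1 - cos \<delta>) \<le> K * (1 - cos (x - y))"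
        unfolding c using \<open>K \<ge> 0\<close> by (intro mult_left_mono) auto
      moreover have "K * (1 - cos \<delta>) = 2 * B" using cos\<delta> by (simp add: K_def)
      moreover have "\<bar>f x - f y\<bar> \<le> 2 * B" using B[of x] B[of y] by linarith
      ultimately show ?thesis using assms(2) by linarith
    qed
  qed
  then show ?thesis by (rule that)
qed

text \<open>Averaging the preceding inequality against the Fejer weights turns the second term into \<open>K / m\<close>.\<close>

lemma C_per_trig_sum_dense:
  assumes "f \<in> C_per" "\<epsilon> > 0"
  obtains N c where "\<And>x. \<bar>f x - trig_sum N c x\<bar> \<le> \<epsilon>"
proof -
  obtain K where K: "\<And>x y. \<bar>f x - f y\<bar> \<le> \<epsilon> / 2 + K * (1 - cos (x - y))"
    using C_per_modulus[OF assms(1), of "\<epsilon> / 2"] assms(2) by auto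
  obtain m :: nat where m: "real m > max 0 (2 * K / \<epsilon>)" using reals_Archimedean2 by blast
  then have "m > 0" "K / real m \<le> \<epsilon> / 2" using assms(2) by (auto simp: field_simps)
  obtain c where c: "fejer_interp m (m + 1) f = trig_sum m c" using fejer_interp_is_trig_sum by blast
  have "\<bar>f x - trig_sum m c x\<bar> \<le> \<epsilon>" for x
  proof -
    let ?u = "\<lambda>l. x - 2 * pi * real l / real (m + 1)"
    have "fejer_interp m (m + 1) (\<lambda>y. f x - f y) x = f x - fejer_interp m (m + 1) f x"
      using sum_fejer_nodes[OF \<open>m > 0\<close>, of "m + 1" x]
      by (simp add: fejer_interp_def right_diff_distrib sum_subtractf diff_divide_distrib flip: sum_distrib_right)
    moreover have "\<bar>fejer_interp m (m + 1) (\<lambda>y. f x - f y) x\<bar>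
       \<le> (\<Sum>l<m + 1. fejer m (?u l) * (\<epsilon> / 2 + K * (1 - cos (?u l)))) / real (m + 1)"
      using K \<open>m > 0\<close> by (intro abs_fejer_interp_le) auto
    moreover have "(\<Sum>l<m + 1. fejer m (?u l) * (\<epsilon> / 2 + K * (1 - cos (?u l))))
        = (\<Sum>l<m + 1. fejer m (?u l)) * (\<epsilon> / 2) + K * (\<Sum>l<m + 1. fejer m (?u l) * (1 - cos (?u l)))"
      by (simp only: sum_distrib_left sum_distrib_right sum.distrib[symmetric])
        (intro sum.cong refl, simp add: algebra_simps)
    moreover have "\<dots> = real (m + 1) * (\<epsilon> / 2 + K / real m)"
      unfolding sum_fejer_nodes_cos[OF \<open>m > 0\<close> order_refl] sum_fejer_nodes[OF \<open>m > 0\<close> le_add1]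
      by (simp only: distrib_left times_divide_eq_right mult.commute)
    ultimately have "\<bar>f x - trig_sum m c x\<bar> \<le> real (m + 1) * (\<epsilon> / 2 + K / real m) / real (m + 1)"
      by (simp only: c)
    then have "\<bar>f x - trig_sum m c x\<bar> \<le> \<epsilon> / 2 + K / real m" by simp
    then show ?thesis using \<open>K / real m \<le> \<epsilon> / 2\<close> by linarith
  qed
  then show ?thesis by (rule that)
qed

section \<open>Multipliers with small second differences\<close>

text \<open>Taylor's formula with remainder for sequences, expanded at the right end \<open>L\<close>. Each factor
  \<open>max 0 (m - j)\<close> is a multiple of the multiplier of a Fejer mean.\<close>

lemma discrete_taylor_at_end:
  fixes \<kappa> :: "nat \<Rightarrow> real"
  assumes "j \<le> L"
  shows "\<kappa> j = \<kappa> L + (real L - real j) * (\<kappa> L - \<kappa> (Suc L))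
     + (\<Sum>l<L. max 0 (real (Suc l) - real j) * (\<kappa> l - 2 * \<kappa> (Suc l) + \<kappa> (Suc (Suc l))))"
  using assms
proof (induction L rule: dec_induct)
  case base
  have "(\<Sum>l<j. max 0 (real (Suc l) - real j) * (\<kappa> l - 2 * \<kappa> (Suc l) + \<kappa> (Suc (Suc l)))) = 0"
    by (intro sum.neutral) (auto simp: max_def)
  then show ?case by simp
next
  case (step L)
  then have "max 0 (real (Suc L) - real j) = real L + 1 - real j" by simp
  with step.IH show ?case by (simp add: algebra_simps)
qed

text \<open>A sequence with small second differences is, up to degree \<open>L\<close>, a combination of the constant
  multiplier and the Fejer multipliers, all of which are contractions. The bound is the sum of the
  absolute values of the coefficients.\<close>

lemma trig_multiplier_bound:
  fixes \<kappa> :: "nat \<Rightarrow> real"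
  assumes "N \<le> L" "L > 0" and bound: "\<And>x. \<bar>trig_sum N c x\<bar> \<le> B"
  shows "\<bar>trig_sum N (\<lambda>j. of_real (\<kappa> j) * c j) x\<bar> \<le>
    (\<bar>\<kappa> L\<bar> + real L * \<bar>\<kappa> L - \<kappa> (Suc L)\<bar>
      + (\<Sum>l<L. real (Suc l) * \<bar>\<kappa> l - 2 * \<kappa> (Suc l) + \<kappa> (Suc (Suc l))\<bar>)) * B"
proof -
  define D where "D l = \<kappa> l - 2 * \<kappa> (Suc l) + \<kappa> (Suc (Suc l))" for l
  define \<sigma> where "\<sigma> m = trig_sum N (\<lambda>j. of_real (max 0 (1 - real j / real m)) * c j) x" for m
  have \<sigma>: "\<bar>\<sigma> m\<bar> \<le> B" if "m > 0" for m
    unfolding \<sigma>_def using that bound by (rule fejer_multiplier_bound)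
  have scale: "max 0 (real m - real j) = real m * max 0 (1 - real j / real m)" if "m > 0" for m j
    using that by (auto simp: max_def field_simps)
  have \<kappa>: "\<kappa> j = \<kappa> L + real L * (\<kappa> L - \<kappa> (Suc L)) * max 0 (1 - real j / real L)
      + (\<Sum>l<L. real (Suc l) * D l * max 0 (1 - real j / real (Suc l)))" if "j \<le> N" for j
  proof -
    have "real L - real j = real L * max 0 (1 - real j / real L)"
      using scale[of L j] that assms by simp
    then show ?thesis
      using discrete_taylor_at_end[of j L \<kappa>] that assms
      by (simp only: scale[OF zero_less_Suc] D_def mult_ac order_trans[OF that])
  qed
  have "trig_sum N (\<lambda>j. of_real (\<kappa> j) * c j) x
     = trig_sum N (\<lambda>j. of_real (\<kappa> L + real L * (\<kappa> L - \<kappa> (Suc L)) * max 0 (1 - real j / real L)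
      + (\<Sum>l<L. real (Suc l) * D l * max 0 (1 - real j / real (Suc l)))) * c j) x"
    unfolding trig_sum_def by (intro sum.cong refl) (simp only: \<kappa>[symmetric] atMost_iff)
  also have "\<dots> = \<kappa> L * trig_sum N c x + real L * (\<kappa> L - \<kappa> (Suc L)) * \<sigma> L + (\<Sum>l<L. real (Suc l) * D l * \<sigma> (Suc l))"
    unfolding \<sigma>_def trig_sum_scale trig_sum_sum
    by (simp only: trig_sum_def sum.distrib[symmetric])
      (simp add: algebra_simps sum_distrib_left sum_distrib_right del: of_nat_Suc)
  finally have eq: "trig_sum N (\<lambda>j. of_real (\<kappa> j) * c j) x = \<dots>" .
  have "\<bar>\<kappa> L * trig_sum N c x\<bar> \<le> \<bar>\<kappa> L\<bar> * B"
    by (simp add: abs_mult mult_left_mono bound)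
  moreover have "\<bar>real L * (\<kappa> L - \<kappa> (Suc L)) * \<sigma> L\<bar> \<le> real L * \<bar>\<kappa> L - \<kappa> (Suc L)\<bar> * B"
    using \<sigma>[OF assms(2)] by (simp add: abs_mult mult_left_mono)
  moreover have "\<bar>\<Sum>l<L. real (Suc l) * D l * \<sigma> (Suc l)\<bar> \<le> (\<Sum>l<L. real (Suc l) * \<bar>D l\<bar> * B)"
    by (intro order_trans[OF sum_abs] sum_mono)
      (simp add: abs_mult mult_left_mono \<sigma> del: of_nat_Suc)
  ultimately show ?thesis
    unfolding eq D_def[symmetric] distrib_right sum_distrib_right by linarith
qed

section \<open>The multiplier of a central difference\<close>

text \<open>The factor by which the centred difference of order \<open>2 k\<close> and step \<open>t\<close>, normalised by
  \<open>(- 1) ^ k * gamma_star (2 * k)\<close>, multiplies a wave of frequency \<open>j\<close>, as a function of \<open>s = j t\<close>.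
  The normalisation makes its mean over a period equal to \<open>1\<close>.\<close>

definition sine_kernel :: "nat \<Rightarrow> real \<Rightarrow> real" where
  "sine_kernel k s = gamma_star (2 * k) * (2 * sin (s / 2)) ^ (2 * k)"

lemma sine_kernel_nonneg: "sine_kernel k s \<ge> 0"
  by (simp add: sine_kernel_def gamma_star_def power_mult)

lemma sine_kernel_0: "k \<ge> 1 \<Longrightarrow> sine_kernel k 0 = 0"
  by (simp add: sine_kernel_def)

text \<open>Write \<open>2 sin (s/2)\<close> as \<open>\<i> cis (- s/2) (1 - cis s)\<close> and expand by the binomial theorem.\<close>

lemma sine_kernel_cis:
  "complex_of_real (sine_kernel k s) =
     of_real (gamma_star (2 * k)) * (-1) ^ k * (\<Sum>i\<le>2 * k. of_real ((-1) ^ i * real (2 * k choose i)) * cis ((real i - real k) * s))"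
proof -
  define z where "z = cis (s / 2)"
  have z: "z * z = cis s" "inverse z = cis (- (s / 2))" "z \<noteq> 0"
    by (simp_all add: z_def cis_mult)
  have "complex_of_real (2 * sin (s / 2)) = (- \<i>) * (z - inverse z)"
    by (simp add: z z_def complex_eq_iff)
  also have "\<dots> = \<i> * inverse z * (1 - cis s)"
    using \<open>z \<noteq> 0\<close> by (simp add: z(1)[symmetric] field_simps)
  finally have "complex_of_real ((2 * sin (s / 2)) ^ (2 * k)) = (\<i> * inverse z * (1 - cis s)) ^ (2 * k)"
    by (metis of_real_power)
  also have "\<dots> = (\<i> ^ 2) ^ k * (inverse z) ^ (2 * k) * (1 - cis s) ^ (2 * k)"
    by (simp only: power_mult_distrib power_mult)
  also have "(inverse z) ^ (2 * k) = cis (- (real k * s))"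
    unfolding z(2) Complex.DeMoivre by (simp add: field_simps)
  also have "(1 - cis s) ^ (2 * k) = (\<Sum>i\<le>2 * k. of_real ((-1) ^ i * real (2 * k choose i)) * cis (real i * s))"
  proof -
    have "(1 - cis s) ^ (2 * k) = ((- cis s) + 1) ^ (2 * k)" by simp
    also have "\<dots> = (\<Sum>i\<le>2 * k. of_nat (2 * k choose i) * (- cis s) ^ i)"
      unfolding binomial_ring by simp
    also have "\<dots> = (\<Sum>i\<le>2 * k. of_real ((-1) ^ i * real (2 * k choose i)) * cis (real i * s))"
      by (intro sum.cong refl) (simp add: power_minus[of "cis s"] Complex.DeMoivre)
    finally show ?thesis .
  qed
  also have "(\<i> ^ 2) ^ k * cis (- (real k * s)) * (\<Sum>i\<le>2 * k. of_real ((-1) ^ i * real (2 * k choose i)) * cis (real i * s))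
     = (-1) ^ k * (\<Sum>i\<le>2 * k. of_real ((-1) ^ i * real (2 * k choose i)) * cis ((real i - real k) * s))"
  proof -
    have *: "cis ((real i - real k) * s) = cis (- (real k * s)) * cis (real i * s)" for i
      by (simp add: cis_mult left_diff_distrib)
    show ?thesis
      unfolding sum_distrib_left power2_i * by (intro sum.cong refl) (simp only: mult_ac)
  qed
  finally show ?thesis
    by (simp add: sine_kernel_def mult.assoc)
qed

lemma fin_diff_trig_sum:
  "gamma_star (2 * k) * (-1) ^ k * fin_diff (2 * k) t (trig_sum N c) (x - real k * t)
     = trig_sum N (\<lambda>j. of_real (sine_kernel k (real j * t)) * c j) x"
proof -
  have "trig_sum N (\<lambda>j. of_real (sine_kernel k (real j * t)) * c j) x
     = (\<Sum>j\<le>N. \<Sum>i\<le>2 * k. gamma_star (2 * k) * (-1) ^ k * ((-1) ^ i * real (2 * k choose i) * Re (c j * cis (real j * (x - real k * t + real i * t)))))"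
    unfolding trig_sum_def
  proof (intro sum.cong refl)
    fix j
    have "of_real (sine_kernel k (real j * t)) * c j * cis (real j * x)
      = (\<Sum>i\<le>2 * k. of_real (gamma_star (2 * k) * (-1) ^ k * ((-1) ^ i * real (2 * k choose i))) * (c j * (cis ((real i - real k) * (real j * t)) * cis (real j * x))))"
      unfolding sine_kernel_cis sum_distrib_left sum_distrib_right
      by (intro sum.cong refl) (simp only: of_real_mult of_real_power of_real_minus of_real_1 mult_ac)
    also have "\<dots> = (\<Sum>i\<le>2 * k. of_real (gamma_star (2 * k) * (-1) ^ k * ((-1) ^ i * real (2 * k choose i))) * (c j * cis (real j * (x - real k * t + real i * t))))"
      unfolding cis_mult by (simp add: algebra_simps)
    finally have "Re (of_real (sine_kernel k (real j * t)) * c j * cis (real j * x)) = Re \<dots>" by (rule arg_cong)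
    also have "\<dots> = (\<Sum>i\<le>2 * k. gamma_star (2 * k) * (-1) ^ k * ((-1) ^ i * real (2 * k choose i)) * Re (c j * cis (real j * (x - real k * t + real i * t))))"
      unfolding Re_sum by (intro sum.cong refl) (simp only: Re_complex_of_real Im_complex_of_real times_complex.sel mult_zero_left diff_zero)
    finally show "Re (of_real (sine_kernel k (real j * t)) * c j * cis (real j * x)) =
      (\<Sum>i\<le>2 * k. gamma_star (2 * k) * (-1) ^ k * ((-1) ^ i * real (2 * k choose i) * Re (c j * cis (real j * (x - real k * t + real i * t)))))"
      by (simp only: mult.assoc)
  qed
  also have "\<dots> = gamma_star (2 * k) * (-1) ^ k * fin_diff (2 * k) t (trig_sum N c) (x - real k * t)"
    unfolding fin_diff_def trig_sum_def atLeast0AtMost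
    by (subst sum.swap) (simp only: sum_distrib_left)
  finally show ?thesis by simp
qed

text \<open>In the Fourier expansion of the kernel the constant term is \<open>1\<close> and the others are cosines of
  nonzero integer frequency. Integration gives \<open>s\<close> plus a combination of sines, which vanish at all
  multiples of pi. Together with positivity this is all that the bounds on the
  antiderivatives below rest on, and it does not depend on \<open>k\<close>.\<close>

lemma sine_kernel_antiderivative:
  obtains J where "\<And>s. (J has_real_derivative sine_kernel k s) (at s)" "\<And>m::nat. J (real m * pi) = real m * pi"
proof -
  define w where "w i = gamma_star (2 * k) * (-1) ^ k * ((-1) ^ i * real (2 * k choose i))" for i
  \<comment> \<open>The middle index carries frequency zero and integrates to the linear term.\<close>
  define q where "q i s = (if i = k then s else sin ((real i - real k) * s) / (real i - real k))" for i s
  define J where "J s = (\<Sum>i\<le>2 * k. w i * q i s)" for s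
  have "gamma_star (2 * k) = inverse (real (2 * k choose k))"
    by (simp add: gamma_star_def)
  then have "w k = ((-1) ^ k * (-1) ^ k) * (inverse (real (2 * k choose k)) * real (2 * k choose k))"
    by (simp only: w_def mult_ac)
  also have "(-1) ^ k * (-1) ^ k = (1 :: real)"
    by (simp flip: power_mult_distrib)
  finally have wk: "w k = 1" by simp
  have kern: "sine_kernel k s = (\<Sum>i\<le>2 * k. w i * cos ((real i - real k) * s))" for s
  proof -
    have "sine_kernel k s = Re (complex_of_real (sine_kernel k s))" by simp
    also have "complex_of_real (sine_kernel k s) = (\<Sum>i\<le>2 * k. of_real (w i) * cis ((real i - real k) * s))"
      unfolding sine_kernel_cis w_def sum_distrib_left
      by (intro sum.cong refl) (simp add: mult_ac)
    finally show ?thesis by (simp add: Re_sum)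
  qed
  have "(q i has_real_derivative cos ((real i - real k) * s)) (at s)" for i s
    unfolding q_def by (cases "i = k") (auto intro!: derivative_eq_intros)
  then have "(J has_real_derivative sine_kernel k s) (at s)" for s
    unfolding J_def kern by (intro DERIV_sum DERIV_cmult)
  moreover have "J (real m * pi) = real m * pi" for m :: nat
  proof -
    have "q i (real m * pi) = (if i = k then real m * pi else 0)" for i
    proof -
      have "sin ((real i - real k) * (real m * pi)) = sin (of_int ((int i - int k) * int m) * pi)"
        by (simp add: mult.assoc)
      also have "\<dots> = 0" by (simp only: sin_times_pi_eq_0) simp
      finally show ?thesis by (simp add: q_def)
    qed
    then show ?thesis
      by (simp add: J_def wk if_distrib[of "\<lambda>y. _ * y"] cong: if_cong)
  qed
  ultimately show ?thesis by (rule that)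
qed

section \<open>Averaging over the step\<close>

lemma antiderivative_on_reals:
  fixes f :: "real \<Rightarrow> real"
  assumes "\<And>x. isCont f x"
  obtains F where "\<And>x. (F has_real_derivative f x) (at x)" "F 0 = 0"
proof -
  obtain F where F: "\<And>x. (F has_vector_derivative f x) (at x)"
    using einterval_antiderivative[of "-\<infinity>" "\<infinity>" f] assms by auto
  have "((\<lambda>x. F x - F 0) has_real_derivative f x) (at x)" for x
    using F[of x] by (auto simp: has_real_derivative_iff_has_vector_derivative intro!: derivative_eq_intros)
  then show ?thesis by (intro that[of "\<lambda>x. F x - F 0"]) auto
qed

lemma le_of_deriv_le:
  fixes F G :: "real \<Rightarrow> real"
  assumes "\<And>x. (F has_real_derivative F' x) (at x)" "\<And>x. (G has_real_derivative G' x) (at x)"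
    and "F a \<le> G a" "\<And>x. a \<le> x \<Longrightarrow> F' x \<le> G' x" "a \<le> b"
  shows "F b \<le> G b"
proof -
  have "F a - G a \<ge> F b - G b"
    by (rule DERIV_nonpos_imp_nonincreasing[OF \<open>a \<le> b\<close>, of "\<lambda>x. F x - G x"])
      (use assms in \<open>auto intro!: exI derivative_eq_intros\<close>)
  with assms(3) show ?thesis by linarith
qed

text \<open>Three successive antiderivatives of the kernel. Three are taken because the weight
  \<open>(h - t)\<^sup>2\<close> used for averaging over the step becomes constant after two integrations by
  parts; the second derivative of the averaged multiplier then involves only \<open>J1\<close>, which stays
  close to its linear part, and not the kernel itself, whose peaks grow with \<open>k\<close>.\<close>

locale kernel_antiderivatives =
  fixes k :: nat and J1 J2 J3 :: "real \<Rightarrow> real"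
  assumes J1: "\<And>s. (J1 has_real_derivative sine_kernel k s) (at s)"
    and J2: "\<And>s. (J2 has_real_derivative J1 s) (at s)"
    and J3: "\<And>s. (J3 has_real_derivative J2 s) (at s)"
    and J2_0: "J2 0 = 0" and J3_0: "J3 0 = 0"
    and J1_pi: "\<And>m::nat. J1 (real m * pi) = real m * pi"
begin

lemma J1_0: "J1 0 = 0"
  using J1_pi[of 0] by simp

lemma J1_mono: "a \<le> b \<Longrightarrow> J1 a \<le> J1 b"
  by (rule DERIV_nonneg_imp_nondecreasing) (use J1 sine_kernel_nonneg in blast)+

text \<open>A nondecreasing function that agrees with the identity at all multiples of pi differs from the
  identity by at most pi.\<close>

lemma J1_near_identity:
  assumes "s \<ge> 0"
  shows "\<bar>J1 s - s\<bar> \<le> pi"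
proof -
  define m where "m = nat \<lfloor>s / pi\<rfloor>"
  have "real m \<le> s / pi" "s / pi \<le> real (Suc m)"
    using assms by (simp_all add: m_def) linarith+
  then have m: "real m * pi \<le> s" "s \<le> real (Suc m) * pi"
    by (simp_all only: pos_le_divide_eq pos_divide_le_eq pi_gt_zero)
  have "real m * pi \<le> J1 s" "J1 s \<le> real (Suc m) * pi"
    using J1_mono[OF m(1)] J1_mono[OF m(2)] unfolding J1_pi by auto
  with m show ?thesis by (auto simp: algebra_simps)
qed

lemma J2_error:
  assumes "s \<ge> 0"
  shows "\<bar>J2 s - s\<^sup>2 / 2\<bar> \<le> pi * s"
proof -
  have d: "((\<lambda>s. J2 s - s\<^sup>2 / 2) has_real_derivative J1 x - x) (at x)" for x
    by (auto intro!: derivative_eq_intros J2)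
  have e: "((\<lambda>s. pi * s) has_real_derivative pi) (at x)" for x
    by (auto intro!: derivative_eq_intros)
  have bounds: "J1 x - x \<le> pi" "- pi \<le> J1 x - x" if "x \<ge> 0" for x
    using J1_near_identity[OF that] by linarith+
  have "J2 s - s\<^sup>2 / 2 \<le> pi * s"
    by (rule le_of_deriv_le[OF d e _ bounds(1) assms]) (simp_all add: J2_0)
  moreover have "- (pi * s) \<le> J2 s - s\<^sup>2 / 2"
    by (rule le_of_deriv_le[OF DERIV_minus[OF e] d _ bounds(2) assms]) (simp_all add: J2_0)
  ultimately show ?thesis by linarith
qed

lemma J3_error:
  assumes "s \<ge> 0"
  shows "\<bar>J3 s - s ^ 3 / 6\<bar> \<le> pi * s\<^sup>2 / 2"
proof -
  have d: "((\<lambda>s. J3 s - s ^ 3 / 6) has_real_derivative J2 x - x\<^sup>2 / 2) (at x)" for x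
    by (auto intro!: derivative_eq_intros J3)
  have e: "((\<lambda>s. pi * s\<^sup>2 / 2) has_real_derivative pi * x) (at x)" for x
    by (auto intro!: derivative_eq_intros)
  have bounds: "J2 x - x\<^sup>2 / 2 \<le> pi * x" "- (pi * x) \<le> J2 x - x\<^sup>2 / 2" if "x \<ge> 0" for x
    using J2_error[OF that] by linarith+
  have "J3 s - s ^ 3 / 6 \<le> pi * s\<^sup>2 / 2"
    by (rule le_of_deriv_le[OF d e _ bounds(1) assms]) (simp_all add: J3_0)
  moreover have "- (pi * s\<^sup>2 / 2) \<le> J3 s - s ^ 3 / 6"
    by (rule le_of_deriv_le[OF DERIV_minus[OF e] d _ bounds(2) assms]) (simp_all add: J3_0)
  ultimately show ?thesis by linarith
qed

lemma J2_nonneg: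
  assumes "s \<ge> 0"
  shows "J2 s \<ge> 0"
  using le_of_deriv_le[of "\<lambda>_. 0" "\<lambda>_. 0" J2 J1 0 s] J1_mono[of 0] J1_0 J2 J2_0 assms by auto

text \<open>Integrate \<open>J1 s \<ge> s - pi\<close> twice from \<open>pi\<close>; on \<open>{0..pi}\<close> nonnegativity is enough.\<close>

lemma J3_lower:
  assumes "y \<ge> pi"
  shows "J3 y \<ge> (y - pi) ^ 3 / 6"
proof -
  have J2_low: "(s - pi)\<^sup>2 / 2 \<le> J2 s" if "s \<ge> pi" for s
  proof (rule le_of_deriv_le[OF _ J2, of "\<lambda>s. (s - pi)\<^sup>2 / 2" "\<lambda>s. s - pi" pi])
    show "((\<lambda>s. (s - pi)\<^sup>2 / 2) has_real_derivative x - pi) (at x)" for x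
      by (auto intro!: derivative_eq_intros)
    show "x - pi \<le> J1 x" if "pi \<le> x" for x
      using J1_near_identity[of x] that pi_gt_zero by linarith
  qed (use that J2_nonneg[of pi] in auto)
  have "J3 0 \<le> J3 pi"
    by (rule DERIV_nonneg_imp_nondecreasing) (use J3 J2_nonneg in \<open>auto intro!: exI\<close>)
  then show ?thesis
    by (intro le_of_deriv_le[of "\<lambda>s. (s - pi) ^ 3 / 6" "\<lambda>s. (s - pi)\<^sup>2 / 2" J3 J2 pi y])
      (use assms J2_low J3_0 in \<open>auto intro!: derivative_eq_intros J3\<close>)
qed

text \<open>The multiplier of the averaged difference at \<open>y = j h\<close>: the mean of the kernel over \<open>{0..y}\<close> with
  weight \<open>3 (y - s)\<^sup>2 / y\<^sup>3\<close>, by Cauchy's formula for repeated integration.\<close>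

definition M :: "real \<Rightarrow> real" where
  "M y = 6 * J3 y / y ^ 3"

definition M' :: "real \<Rightarrow> real" where
  "M' y = 6 * J2 y / y ^ 3 - 18 * J3 y / y ^ 4"

definition M'' :: "real \<Rightarrow> real" where
  "M'' y = 6 * J1 y / y ^ 3 - 36 * J2 y / y ^ 4 + 72 * J3 y / y ^ 5"

lemma M_deriv: "y > 0 \<Longrightarrow> (M has_real_derivative M' y) (at y)"
  unfolding M_def M'_def
  by (rule derivative_eq_intros J3 refl | simp)+
    (simp add: field_simps power_numeral_reduce)

lemma M'_deriv: "y > 0 \<Longrightarrow> (M' has_real_derivative M'' y) (at y)"
  unfolding M'_def M''_def
  by (rule derivative_eq_intros J3 J2 refl | simp)+
    (simp add: field_simps power_numeral_reduce)

text \<open>The lower bound \<open>(1 - pi / y) ^ 3\<close> stays away from zero on \<open>y \<ge> \<alpha> * pi\<close>, uniformly in \<open>k\<close>.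
  This is the place where \<open>\<alpha> > 1\<close> is essential.\<close>

lemma M_lower:
  assumes "\<alpha> > 1" "y \<ge> \<alpha> * pi"
  shows "M y \<ge> (1 - 1 / \<alpha>) ^ 3"
proof -
  have "1 * pi \<le> \<alpha> * pi" using assms by (intro mult_right_mono) auto
  then have "y \<ge> pi" using assms by linarith
  then have "y > 0" using pi_gt_zero by linarith
  have "pi / y \<le> 1 / \<alpha>"
    using assms \<open>y > 0\<close> by (simp add: field_simps)
  then have "(1 - 1 / \<alpha>) ^ 3 \<le> (1 - pi / y) ^ 3"
    using assms by (intro power_mono) auto
  also have "\<dots> = 6 * ((y - pi) ^ 3 / 6) / y ^ 3"
    using \<open>y > 0\<close> by (simp add: diff_divide_distrib flip: power_divide)
  also have "\<dots> \<le> M y"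
    unfolding M_def using J3_lower[OF \<open>y \<ge> pi\<close>] \<open>y > 0\<close> by (intro divide_right_mono mult_left_mono) auto
  finally show ?thesis .
qed

text \<open>The polynomial parts \<open>y\<^sup>2 / 2\<close> and \<open>y ^ 3 / 6\<close> of \<open>J2\<close> and \<open>J3\<close> correspond to the constant
  multiplier \<open>1\<close> and cancel in the derivatives, so that only the error terms remain.\<close>

lemma M'_bound:
  assumes "y > 0"
  shows "\<bar>M' y\<bar> \<le> 15 * pi / y\<^sup>2"
proof -
  have "M' y = 6 * (J2 y - y\<^sup>2 / 2) / y ^ 3 - 18 * (J3 y - y ^ 3 / 6) / y ^ 4"
    using assms by (simp add: M'_def field_simps power_numeral_reduce)
  moreover have "\<bar>6 * (J2 y - y\<^sup>2 / 2) / y ^ 3\<bar> \<le> 6 * (pi * y) / y ^ 3"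
    using assms J2_error[of y] by (simp add: abs_mult divide_right_mono)
  moreover have "\<bar>18 * (J3 y - y ^ 3 / 6) / y ^ 4\<bar> \<le> 18 * (pi * y\<^sup>2 / 2) / y ^ 4"
    using assms J3_error[of y] by (simp only: abs_mult abs_divide) (simp add: divide_right_mono)
  ultimately have "\<bar>M' y\<bar> \<le> 6 * (pi * y) / y ^ 3 + 18 * (pi * y\<^sup>2 / 2) / y ^ 4" by linarith
  also have "\<dots> = 15 * pi / y\<^sup>2"
    using assms by (simp add: field_simps power_numeral_reduce)
  finally show ?thesis .
qed

lemma M''_bound:
  assumes "y > 0"
  shows "\<bar>M'' y\<bar> \<le> 78 * pi / y ^ 3"
proof -
  have "M'' y = 6 * (J1 y - y) / y ^ 3 - 36 * (J2 y - y\<^sup>2 / 2) / y ^ 4 + 72 * (J3 y - y ^ 3 / 6) / y ^ 5"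
    using assms by (simp add: M''_def field_simps power_numeral_reduce)
  moreover have "\<bar>6 * (J1 y - y) / y ^ 3\<bar> \<le> 6 * pi / y ^ 3"
    using assms J1_near_identity[of y] by (simp add: abs_mult divide_right_mono)
  moreover have "\<bar>36 * (J2 y - y\<^sup>2 / 2) / y ^ 4\<bar> \<le> 36 * (pi * y) / y ^ 4"
    using assms J2_error[of y] by (simp only: abs_mult abs_divide) (simp add: divide_right_mono)
  moreover have "\<bar>72 * (J3 y - y ^ 3 / 6) / y ^ 5\<bar> \<le> 72 * (pi * y\<^sup>2 / 2) / y ^ 5"
    using assms J3_error[of y] by (simp only: abs_mult abs_divide) (simp add: divide_right_mono)
  ultimately have "\<bar>M'' y\<bar> \<le> 6 * pi / y ^ 3 + 36 * (pi * y) / y ^ 4 + 72 * (pi * y\<^sup>2 / 2) / y ^ 5" by linarith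
  also have "\<dots> = 78 * pi / y ^ 3"
    using assms by (simp add: field_simps power_numeral_reduce)
  finally show ?thesis .
qed

lemma weighted_kernel_integral:
  fixes h x :: real
  assumes "k \<ge> 1" "h > 0"
  shows "((\<lambda>t. 3 * (h - t)\<^sup>2 / h ^ 3 * sine_kernel k (x * t)) has_integral M (x * h)) {0..h}"
proof (cases "x = 0")
  case True
  then show ?thesis using assms by (simp add: M_def sine_kernel_0)
next
  case False
  \<comment> \<open>Repeated integration by parts; two derivatives fall on the weight.\<close>
  define F where "F t = 3 / h ^ 3 * ((h - t)\<^sup>2 * J1 (x * t) / x + 2 * (h - t) * J2 (x * t) / x\<^sup>2 + 2 * J3 (x * t) / x ^ 3)" for t
  have chain: "((\<lambda>t. J1 (x * t)) has_real_derivative sine_kernel k (x * t) * x) (at t)"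
    "((\<lambda>t. J2 (x * t)) has_real_derivative J1 (x * t) * x) (at t)"
    "((\<lambda>t. J3 (x * t)) has_real_derivative J2 (x * t) * x) (at t)" for t
    by (auto intro!: DERIV_chain2[of _ _ "\<lambda>t. x * t"] J1 J2 J3 derivative_eq_intros)
  have "(F has_real_derivative 3 * (h - t)\<^sup>2 / h ^ 3 * sine_kernel k (x * t)) (at t)" for t
    unfolding F_def
    by (rule derivative_eq_intros chain refl | simp add: False)+
      (use False assms in \<open>simp add: field_simps power_numeral_reduce\<close>)
  then have "((\<lambda>t. 3 * (h - t)\<^sup>2 / h ^ 3 * sine_kernel k (x * t)) has_integral F h - F 0) {0..h}"
    using assms by (intro fundamental_theorem_of_calculus)
      (auto simp: has_real_derivative_iff_has_vector_derivative[symmetric] intro: has_field_derivative_at_within)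
  moreover have "F h - F 0 = M (x * h)"
    by (simp add: F_def M_def J1_0 J2_0 J3_0 power_mult_distrib)
  ultimately show ?thesis by simp
qed

text \<open>The multiplied sum is an average over the step \<open>t\<close>, with a probability density, of normalised
  differences of step at most \<open>h\<close>; each of these is bounded by assumption.\<close>

lemma averaged_trig_sum_bound:
  assumes "k \<ge> 1" "h > 0"
    and bound: "\<And>t x. 0 < t \<Longrightarrow> t \<le> h \<Longrightarrow> \<bar>fin_diff (2 * k) t (trig_sum N c) x\<bar> \<le> B"
  shows "\<bar>trig_sum N (\<lambda>j. of_real (M (real j * h)) * c j) x\<bar> \<le> gamma_star (2 * k) * B"
proof -
  define D where "D t = trig_sum N (\<lambda>j. of_real (sine_kernel k (real j * t)) * c j) x" for t
  define \<phi> where "\<phi> t = 3 * (h - t)\<^sup>2 / h ^ 3" for t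
  have B: "B \<ge> 0" using bound[of h x] assms(2) by linarith
  have \<gamma>: "gamma_star (2 * k) \<ge> 0" by (simp add: gamma_star_def)
  have D: "\<bar>D t\<bar> \<le> gamma_star (2 * k) * B" if "t \<in> {0..h}" for t
  proof (cases "t = 0")
    case True
    then show ?thesis using \<open>k \<ge> 1\<close> B \<gamma> by (simp add: D_def trig_sum_def sine_kernel_0)
  next
    case False
    then have "\<bar>fin_diff (2 * k) t (trig_sum N c) (x - real k * t)\<bar> \<le> B"
      using that by (intro bound) auto
    then show ?thesis
      unfolding D_def fin_diff_trig_sum[symmetric] using \<gamma> by (simp add: abs_mult power_abs mult_left_mono)
  qed
  have "((\<lambda>t. \<Sum>j\<le>N. \<phi> t * sine_kernel k (real j * t) * Re (c j * cis (real j * x))) has_integral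
      (\<Sum>j\<le>N. M (real j * h) * Re (c j * cis (real j * x)))) {0..h}"
    unfolding \<phi>_def using assms
    by (intro has_integral_sum has_integral_mult_left weighted_kernel_integral) auto
  also have "(\<lambda>t. \<Sum>j\<le>N. \<phi> t * sine_kernel k (real j * t) * Re (c j * cis (real j * x))) = (\<lambda>t. \<phi> t * D t)"
    by (simp add: D_def trig_sum_def sum_distrib_left fun_eq_iff algebra_simps)
  also have "(\<Sum>j\<le>N. M (real j * h) * Re (c j * cis (real j * x))) = trig_sum N (\<lambda>j. of_real (M (real j * h)) * c j) x"
    by (simp add: trig_sum_def algebra_simps)
  finally have I: "((\<lambda>t. \<phi> t * D t) has_integral trig_sum N (\<lambda>j. of_real (M (real j * h)) * c j) x) {0..h}" .
  have "((\<lambda>t. - ((h - t) ^ 3 / h ^ 3)) has_real_derivative \<phi> t) (at t)" for t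
    unfolding \<phi>_def using assms(2) by (auto intro!: derivative_eq_intros simp: field_simps power_numeral_reduce)
  then have "(\<phi> has_integral - ((h - h) ^ 3 / h ^ 3) - - ((h - 0) ^ 3 / h ^ 3)) {0..h}"
    using assms by (intro fundamental_theorem_of_calculus)
      (auto simp: has_real_derivative_iff_has_vector_derivative[symmetric] intro: has_field_derivative_at_within)
  then have "(\<phi> has_integral 1) {0..h}" using assms by simp
  from has_integral_mult_left[OF this, of "gamma_star (2 * k) * B"]
  have U: "((\<lambda>t. \<phi> t * (gamma_star (2 * k) * B)) has_integral gamma_star (2 * k) * B) {0..h}" by simp
  have \<phi>: "\<phi> t \<ge> 0" for t using assms by (simp add: \<phi>_def)
  have "trig_sum N (\<lambda>j. of_real (M (real j * h)) * c j) x \<le> gamma_star (2 * k) * B"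
    by (rule has_integral_le[OF I U]) (use D \<phi> in \<open>auto intro!: mult_left_mono simp: abs_le_iff\<close>)
  moreover have "- trig_sum N (\<lambda>j. of_real (M (real j * h)) * c j) x \<le> gamma_star (2 * k) * B"
  proof (rule has_integral_le[OF has_integral_neg[OF I] U])
    fix t assume "t \<in> {0..h}"
    then have "\<phi> t * (- D t) \<le> \<phi> t * (gamma_star (2 * k) * B)"
      using D[of t] by (intro mult_left_mono \<phi>) auto
    then show "- (\<phi> t * D t) \<le> \<phi> t * (gamma_star (2 * k) * B)" by simp
  qed
  ultimately show ?thesis by linarith
qed

end

lemma kernel_antiderivatives_exist:
  obtains J1 J2 J3 where "kernel_antiderivatives k J1 J2 J3"
proof -
  obtain J1 where J1: "\<And>s. (J1 has_real_derivative sine_kernel k s) (at s)" "\<And>m::nat. J1 (real m * pi) = real m * pi"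
    using sine_kernel_antiderivative[of k] by blast
  obtain J2 where J2: "\<And>s. (J2 has_real_derivative J1 s) (at s)" "J2 0 = 0"
    using antiderivative_on_reals[of J1] J1(1) DERIV_isCont by blast
  obtain J3 where J3: "\<And>s. (J3 has_real_derivative J2 s) (at s)" "J3 0 = 0"
    using antiderivative_on_reals[of J2] J2(1) DERIV_isCont by blast
  show ?thesis
    by (rule that[of J1 J2 J3], unfold_locales) (use J1 J2 J3 in auto)
qed

section \<open>Inverting the averaged difference\<close>

lemma second_difference_bound:
  fixes f f' f'' :: "real \<Rightarrow> real"
  assumes f: "\<And>x. x \<ge> a \<Longrightarrow> (f has_real_derivative f' x) (at x)"
    and f': "\<And>x. x \<ge> a \<Longrightarrow> (f' has_real_derivative f'' x) (at x)"
    and bound: "\<And>x. x \<ge> a \<Longrightarrow> \<bar>f'' x\<bar> \<le> K" and "h > 0"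
  shows "\<bar>f a - 2 * f (a + h) + f (a + 2 * h)\<bar> \<le> K * h\<^sup>2"
proof -
  have "((\<lambda>x. f (x + h) - f x) has_real_derivative f' (x + h) - f' x) (at x)" if "x \<ge> a" for x
    using f[of "x + h"] f[of x] that \<open>h > 0\<close> by (intro DERIV_diff) (simp_all add: DERIV_shift)
  then obtain \<xi> where \<xi>: "\<xi> > a" "f (a + h + h) - f (a + h) - (f (a + h) - f a) = h * (f' (\<xi> + h) - f' \<xi>)"
    using MVT2[of a "a + h" "\<lambda>x. f (x + h) - f x" "\<lambda>x. f' (x + h) - f' x"] \<open>h > 0\<close> by auto
  obtain \<eta> where \<eta>: "\<eta> > \<xi>" "f' (\<xi> + h) - f' \<xi> = h * f'' \<eta>"
    using MVT2[of \<xi> "\<xi> + h" f' f''] f' \<xi>(1) \<open>h > 0\<close> by auto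
  have "f a - 2 * f (a + h) + f (a + 2 * h) = f'' \<eta> * h\<^sup>2"
    using \<xi>(2) unfolding \<eta>(2) by (simp add: algebra_simps power2_eq_square)
  then show ?thesis
    using bound[of \<eta>] \<xi> \<eta> by (simp add: abs_mult mult_right_mono)
qed

text \<open>The second differences below vanish before the kink of the sequence at \<open>n\<close>, the kink itself
  contributes \<open>A\<close>, and the rest is compared with the telescoping series of \<open>1 / l - 1 / (l + 1)\<close>.\<close>

lemma sum_inverse_square_tail:
  fixes u :: "nat \<Rightarrow> real"
  assumes "n \<ge> 1" "n \<le> L" "K \<ge> 0"
    and "\<And>l. Suc l < n \<Longrightarrow> u l = 0" "u (n - 1) \<le> A" "\<And>l. l \<ge> n \<Longrightarrow> u l \<le> K / (real l)\<^sup>2"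
  shows "(\<Sum>l<L. u l) \<le> A + 2 * K * (1 / real n - 1 / real L)"
  using \<open>n \<le> L\<close>
proof (induction L rule: dec_induct)
  case base
  have "(\<Sum>l<n. u l) = (\<Sum>l\<in>{n - 1}. u l)"
  proof (rule sum.mono_neutral_right)
    show "\<forall>l\<in>{..<n} - {n - 1}. u l = 0"
    proof
      fix l assume "l \<in> {..<n} - {n - 1}"
      then show "u l = 0" by (intro assms(4)) auto
    qed
  qed (use \<open>n \<ge> 1\<close> in auto)
  then show ?case using assms by simp
next
  case (step L)
  have "L \<ge> 1" using step assms by simp
  have "K / (real L)\<^sup>2 \<le> 2 * K / (real L * real (Suc L))"
  proof -
    have "real L * real (Suc L) \<le> 2 * (real L)\<^sup>2"
      using \<open>L \<ge> 1\<close> by (simp add: power2_eq_square)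
    then have "2 * K / (2 * (real L)\<^sup>2) \<le> 2 * K / (real L * real (Suc L))"
      using \<open>L \<ge> 1\<close> \<open>K \<ge> 0\<close> by (intro divide_left_mono) auto
    then show ?thesis by simp
  qed
  also have "\<dots> = 2 * K * (1 / real L - 1 / real (Suc L))"
    using \<open>L \<ge> 1\<close> by (simp add: field_simps)
  finally have "u L \<le> 2 * K * (1 / real L - 1 / real (Suc L))"
    using assms(6)[of L] step by simp
  with step.IH show ?case by (simp add: algebra_simps del: of_nat_Suc)
qed

text \<open>Here \<open>q\<close> is the lower bound of the multiplier \<open>M\<close>. The terms collect the value, the first
  difference and the second differences of the reciprocal multiplier: \<open>342 = 15 + 15 + 4 * 78\<close> and
  \<open>1800 = 4 * 450\<close>.\<close>

definition jackson_const :: "real \<Rightarrow> real" where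
  "jackson_const \<alpha> = (let q = (1 - 1 / \<alpha>) ^ 3 in 1 / q + 342 / q\<^sup>2 + 1800 / q ^ 3)"

lemma jackson_const_nonneg: "\<alpha> > 1 \<Longrightarrow> jackson_const \<alpha> \<ge> 0"
  by (simp add: jackson_const_def Let_def)

context kernel_antiderivatives
begin

definition R :: "real \<Rightarrow> real" where
  "R y = 1 / M y"

definition R' :: "real \<Rightarrow> real" where
  "R' y = - M' y / (M y)\<^sup>2"

definition R'' :: "real \<Rightarrow> real" where
  "R'' y = - M'' y / (M y)\<^sup>2 + 2 * (M' y)\<^sup>2 / (M y) ^ 3"

lemma R_bounds:
  assumes "\<alpha> > 1" "y \<ge> \<alpha> * pi"
  defines "q \<equiv> (1 - 1 / \<alpha>) ^ 3"
  shows "(R has_real_derivative R' y) (at y)" "(R' has_real_derivative R'' y) (at y)"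
    "\<bar>R y\<bar> \<le> 1 / q" "\<bar>R' y\<bar> \<le> 15 * pi / q\<^sup>2 / y\<^sup>2" "\<bar>R'' y\<bar> \<le> (78 / q\<^sup>2 + 450 / q ^ 3) * pi / y ^ 3"
proof -
  have "1 * pi \<le> \<alpha> * pi" using assms by (intro mult_right_mono) auto
  then have y: "y \<ge> pi" "y > 0" using assms pi_gt_zero by linarith+
  have q: "q > 0" using assms by simp
  have M: "M y \<ge> q" unfolding q_def using assms by (intro M_lower) auto
  then have M0: "M y > 0" using q by linarith
  note Md = M_deriv[OF y(2)] M'_deriv[OF y(2)]
  show "(R has_real_derivative R' y) (at y)"
    unfolding R_def R'_def using M0 by (auto intro!: derivative_eq_intros Md simp: power2_eq_square)
  show "(R' has_real_derivative R'' y) (at y)"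
    unfolding R'_def R''_def using M0
    by (auto intro!: derivative_eq_intros Md simp: field_simps power_numeral_reduce)
  show "\<bar>R y\<bar> \<le> 1 / q"
    using M M0 q by (simp add: R_def frac_le)
  have sq: "q\<^sup>2 \<le> (M y)\<^sup>2" and cb: "q ^ 3 \<le> (M y) ^ 3"
    using M q by (simp_all add: power_mono)
  have "\<bar>R' y\<bar> = \<bar>M' y\<bar> / (M y)\<^sup>2" by (simp add: R'_def)
  also have "\<dots> \<le> (15 * pi / y\<^sup>2) / q\<^sup>2"
    using M'_bound[OF y(2)] sq q by (intro frac_le) auto
  finally show "\<bar>R' y\<bar> \<le> 15 * pi / q\<^sup>2 / y\<^sup>2" by (simp add: field_simps)
  have "\<bar>R'' y\<bar> \<le> \<bar>M'' y\<bar> / (M y)\<^sup>2 + 2 * (M' y)\<^sup>2 / (M y) ^ 3"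
    using M0 abs_triangle_ineq[of "- M'' y / (M y)\<^sup>2" "2 * (M' y)\<^sup>2 / (M y) ^ 3"]
    by (simp add: R''_def)
  also have "\<dots> \<le> (78 * pi / y ^ 3) / q\<^sup>2 + (450 * pi / y ^ 3) / q ^ 3"
  proof (intro add_mono frac_le)
    have "(M' y)\<^sup>2 \<le> (15 * pi / y\<^sup>2)\<^sup>2"
      using power_mono[OF M'_bound[OF y(2)] abs_ge_zero, of 2] by simp
    also have "\<dots> = 225 * pi * (pi / y ^ 4)" by (simp add: power2_eq_square power_numeral_reduce)
    also have "\<dots> \<le> 225 * pi * (1 / y ^ 3)"
      using y by (intro mult_left_mono) (simp_all add: field_simps power_numeral_reduce)
    finally show "2 * (M' y)\<^sup>2 \<le> 450 * pi / y ^ 3" by simp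
  qed (use M''_bound[OF y(2)] sq cb q y in auto)
  finally show "\<bar>R'' y\<bar> \<le> (78 / q\<^sup>2 + 450 / q ^ 3) * pi / y ^ 3"
    by (simp add: add_divide_distrib algebra_simps)
qed

text \<open>The reciprocal multiplier is needed for frequencies \<open>j \<ge> n\<close> only. Below \<open>n\<close> it is continued by its
  value at \<open>n\<close>, which costs one bounded term at the kink, and the decay of \<open>R''\<close> controls
  the second differences above \<open>n\<close>. Since \<open>n h = \<alpha> pi\<close>, the result is free of \<open>n\<close>.\<close>

lemma inverse_multiplier_bound:
  assumes "\<alpha> > 1" "n \<ge> 1" and bound: "\<And>x. \<bar>trig_sum N c x\<bar> \<le> B"
  shows "\<bar>trig_sum N (\<lambda>j. of_real (R (real (max j n) * (\<alpha> * pi / real n))) * c j) x\<bar> \<le> jackson_const \<alpha> * B"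
proof -
  define h where "h = \<alpha> * pi / real n"
  define q where "q = (1 - 1 / \<alpha>) ^ 3"
  define \<kappa> where "\<kappa> j = R (real (max j n) * h)" for j
  define L where "L = max N n"
  define u where "u l = real (Suc l) * \<bar>\<kappa> l - 2 * \<kappa> (Suc l) + \<kappa> (Suc (Suc l))\<bar>" for l
  define K where "K = (78 / q\<^sup>2 + 450 / q ^ 3) * pi"
  have h: "h > 0" "real n * h = \<alpha> * pi" using assms by (simp_all add: h_def)
  have q: "q > 0" using assms by (simp add: q_def)
  have K: "K \<ge> 0" using q by (simp add: K_def)
  have B: "B \<ge> 0" using bound[of x] by linarith
  have L: "N \<le> L" "n \<le> L" "L > 0" using assms by (auto simp: L_def)
  have "1 * pi \<le> \<alpha> * pi" using assms by (intro mult_right_mono) auto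
  then have nh: "real n * h \<ge> pi" using h by simp
  have far: "real l * h \<ge> \<alpha> * pi" if "l \<ge> n" for l
    using that h by (metis mult_right_mono of_nat_le_iff less_imp_le)
  note Rb = R_bounds[OF assms(1), folded q_def K_def]
  have first: "real l * \<bar>\<kappa> l - \<kappa> (Suc l)\<bar> \<le> 15 / q\<^sup>2" if "l \<ge> n" for l
  proof -
    let ?a = "real l * h"
    have a: "?a \<ge> \<alpha> * pi" "?a \<ge> pi" using far[OF that] \<open>1 * pi \<le> \<alpha> * pi\<close> by linarith+
    have a0: "?a > 0" using a pi_gt_zero by linarith
    obtain z where z: "z > ?a" "R (?a + h) - R ?a = h * R' z"
      using MVT2[of ?a "?a + h" R R'] Rb(1) a h by fastforce
    have "\<bar>R' z\<bar> \<le> 15 * pi / q\<^sup>2 / z\<^sup>2" using Rb(4)[of z] z a by simp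
    also have "\<dots> \<le> 15 * pi / q\<^sup>2 / ?a\<^sup>2"
      using z a0 by (intro divide_left_mono power_mono mult_pos_pos[OF zero_less_power zero_less_power]) auto
    finally have "real l * h * \<bar>R' z\<bar> \<le> ?a * (15 * pi / q\<^sup>2 / ?a\<^sup>2)"
      using h by (intro mult_left_mono) auto
    also have "\<dots> = 15 / q\<^sup>2 * (pi / ?a)" using a0 by (simp add: field_simps power2_eq_square)
    also have "\<dots> \<le> 15 / q\<^sup>2 * 1" using a a0 by (intro mult_left_mono) auto
    finally have "real l * h * \<bar>R' z\<bar> \<le> 15 / q\<^sup>2" by simp
    moreover have "\<bar>\<kappa> l - \<kappa> (Suc l)\<bar> = h * \<bar>R' z\<bar>"
    proof -
      have "real (Suc l) * h = ?a + h" by (simp add: algebra_simps)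
      then have "\<kappa> l - \<kappa> (Suc l) = - (h * R' z)"
        using that z(2) by (simp add: \<kappa>_def max_def del: of_nat_Suc)
      then show ?thesis using h by (simp add: abs_mult)
    qed
    ultimately show ?thesis by simp
  qed
  have "(\<Sum>l<L. u l) \<le> 15 / q\<^sup>2 + 2 * (2 * K / h) * (1 / real n - 1 / real L)"
  proof (rule sum_inverse_square_tail)
    show "u l = 0" if "Suc l < n" for l using that by (simp add: u_def \<kappa>_def max_def)
    show "u (n - 1) \<le> 15 / q\<^sup>2"
    proof -
      have "\<kappa> (n - 1) = \<kappa> n" by (simp add: \<kappa>_def max_def)
      then have "u (n - 1) = real n * \<bar>\<kappa> (Suc n) - \<kappa> n\<bar>"
        using assms by (simp add: u_def)
      with first[of n] show ?thesis by (simp add: abs_minus_commute)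
    qed
    show "u l \<le> (2 * K / h) / (real l)\<^sup>2" if "l \<ge> n" for l
    proof -
      let ?a = "real l * h"
      have l: "real l \<ge> 1" using that assms by simp
      have a: "?a \<ge> \<alpha> * pi" using far[OF that] .
      have a0: "?a > 0" using l h by simp
      have "\<bar>R ?a - 2 * R (?a + h) + R (?a + 2 * h)\<bar> \<le> K / ?a ^ 3 * h\<^sup>2"
      proof (rule second_difference_bound)
        fix y assume y: "y \<ge> ?a"
        show "(R has_real_derivative R' y) (at y)" "(R' has_real_derivative R'' y) (at y)"
          using Rb(1,2)[of y] y a by auto
        have "\<bar>R'' y\<bar> \<le> K / y ^ 3" unfolding K_def using Rb(5)[of y] y a by auto
        also have "\<dots> \<le> K / ?a ^ 3"
          using y a0 K by (intro divide_left_mono power_mono) auto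
        finally show "\<bar>R'' y\<bar> \<le> K / ?a ^ 3" .
      qed (use h in auto)
      moreover have "real (Suc l) * h = ?a + h" "real (Suc (Suc l)) * h = ?a + 2 * h"
        by (simp_all add: algebra_simps)
      then have "\<kappa> l - 2 * \<kappa> (Suc l) + \<kappa> (Suc (Suc l)) = R ?a - 2 * R (?a + h) + R (?a + 2 * h)"
        using that by (simp add: \<kappa>_def max_def del: of_nat_Suc)
      ultimately have "u l \<le> (2 * real l) * (K / ?a ^ 3 * h\<^sup>2)"
        unfolding u_def using l a0 K by (intro mult_mono) auto
      also have "\<dots> = (2 * K / h) / (real l)\<^sup>2"
        using l h by (simp add: field_simps power_numeral_reduce)
      finally show ?thesis .
    qed
  qed (use assms L K h in auto)
  also have "\<dots> \<le> 15 / q\<^sup>2 + 2 * (2 * K / h) * (1 / real n)"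
    using K h by (intro add_left_mono mult_left_mono) auto
  also have "\<dots> = 15 / q\<^sup>2 + 4 * (K / (real n * h))" by (simp add: mult.commute)
  also have "\<dots> \<le> 15 / q\<^sup>2 + 4 * (K / pi)"
    using nh K h assms by (intro add_left_mono mult_left_mono divide_left_mono) auto
  finally have sum: "(\<Sum>l<L. u l) \<le> 15 / q\<^sup>2 + 4 * (78 / q\<^sup>2 + 450 / q ^ 3)" by (simp add: K_def)
  have "\<bar>\<kappa> L\<bar> \<le> 1 / q" using Rb(3)[of "real L * h"] far[of L] L by (simp add: \<kappa>_def max_def)
  then have "\<bar>\<kappa> L\<bar> + real L * \<bar>\<kappa> L - \<kappa> (Suc L)\<bar> + (\<Sum>l<L. u l) \<le> 1 / q + 15 / q\<^sup>2 + (15 / q\<^sup>2 + 4 * (78 / q\<^sup>2 + 450 / q ^ 3))"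
    using first[of L] L sum by (intro add_mono) auto
  also have "\<dots> = jackson_const \<alpha>"
    by (simp add: jackson_const_def q_def[symmetric] Let_def algebra_simps)
  finally have "(\<bar>\<kappa> L\<bar> + real L * \<bar>\<kappa> L - \<kappa> (Suc L)\<bar> + (\<Sum>l<L. u l)) * B \<le> jackson_const \<alpha> * B"
    using B by (rule mult_right_mono)
  with trig_multiplier_bound[OF L(1,3) bound, of \<kappa> x] show ?thesis
    unfolding u_def \<kappa>_def h_def by linarith
qed

text \<open>Dividing out the multiplier of the averaged difference restores every frequency \<open>j \<ge> n\<close>. What is
  not restored has degree below \<open>n\<close> and serves as the approximant.\<close>

lemma trig_sum_jackson:
  assumes "\<alpha> > 1" "k \<ge> 1" "n \<ge> 1"
    and bound: "\<And>t x. 0 < t \<Longrightarrow> t \<le> \<alpha> * pi / real n \<Longrightarrow> \<bar>fin_diff (2 * k) t (trig_sum N c) x\<bar> \<le> B"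
  obtains \<tau> where "\<tau> \<in> trig_polys (n - 1)"
    "\<And>x. \<bar>trig_sum N c x - \<tau> x\<bar> \<le> jackson_const \<alpha> * (gamma_star (2 * k) * B)"
proof -
  define h where "h = \<alpha> * pi / real n"
  define \<kappa> where "\<kappa> j = R (real (max j n) * h)" for j
  define d where "d j = of_real (M (real j * h)) * c j" for j
  have h: "h > 0" "real n * h = \<alpha> * pi" using assms by (simp_all add: h_def)
  have avg: "\<bar>trig_sum N d x\<bar> \<le> gamma_star (2 * k) * B" for x
    unfolding d_def using assms h bound by (intro averaged_trig_sum_bound) (auto simp: h_def)
  have G: "\<bar>trig_sum N (\<lambda>j. of_real (\<kappa> j) * d j) x\<bar> \<le> jackson_const \<alpha> * (gamma_star (2 * k) * B)" for x
    unfolding \<kappa>_def h_def using assms avg by (intro inverse_multiplier_bound)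
  have inv: "of_real (\<kappa> j) * d j = c j" if "j \<ge> n" for j
  proof -
    have "real j * h \<ge> \<alpha> * pi"
      using that h by (metis mult_right_mono of_nat_le_iff less_imp_le)
    then have "M (real j * h) \<ge> (1 - 1 / \<alpha>) ^ 3" using assms by (intro M_lower)
    moreover have "(1 - 1 / \<alpha>) ^ 3 > 0" using assms by simp
    ultimately have "M (real j * h) \<noteq> 0" by linarith
    then show ?thesis using that by (simp add: \<kappa>_def d_def R_def max_def)
  qed
  show ?thesis
  proof (rule that)
    show "trig_sum N (\<lambda>j. c j - of_real (\<kappa> j) * d j) \<in> trig_polys (n - 1)"
      by (rule trig_sum_supported) (use inv in auto)
    show "\<bar>trig_sum N c x - trig_sum N (\<lambda>j. c j - of_real (\<kappa> j) * d j) x\<bar> \<le> jackson_const \<alpha> * (gamma_star (2 * k) * B)" for x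
      using G[of x] by (simp add: trig_sum_diff)
  qed
qed

end

section \<open>Best approximation and modulus of smoothness\<close>

lemma abs_fin_diff_le:
  assumes "\<And>x. \<bar>f x\<bar> \<le> B"
  shows "\<bar>fin_diff r h f x\<bar> \<le> 2 ^ r * B"
proof -
  have "\<bar>fin_diff r h f x\<bar> \<le> (\<Sum>i = 0..r. real (r choose i) * B)"
    unfolding fin_diff_def
    by (intro order_trans[OF sum_abs] sum_mono) (simp add: abs_mult power_abs mult_left_mono assms)
  also have "\<dots> = real (\<Sum>i\<le>r. r choose i) * B"
    by (simp add: sum_distrib_right atLeast0AtMost)
  also have "\<dots> = 2 ^ r * B" by (simp add: choose_row_sum)
  finally show ?thesis .
qed

lemma fin_diff_diff: "fin_diff r h f x - fin_diff r h g x = fin_diff r h (\<lambda>y. f y - g y) x"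
  by (simp add: fin_diff_def right_diff_distrib sum_subtractf)

lemma fin_diff_Suc: "fin_diff (Suc r) h f x = fin_diff r h f x - fin_diff r h f (x + h)"
proof -
  define g where "g i = f (x + real i * h)" for i
  have shift: "f (x + h + real i * h) = g (Suc i)" for i by (simp add: g_def algebra_simps)
  have "(\<Sum>i\<le>r. (-1) ^ i * real (r choose i) * g i) = (\<Sum>i\<le>Suc r. (-1) ^ i * real (r choose i) * g i)"
    by simp
  also have "\<dots> = g 0 - (\<Sum>i\<le>r. (-1) ^ i * real (r choose Suc i) * g (Suc i))"
    by (simp add: sum.atMost_Suc_shift sum_negf del: sum.atMost_Suc)
  finally have row: "(\<Sum>i\<le>r. (-1) ^ i * real (r choose i) * g i)
      = g 0 - (\<Sum>i\<le>r. (-1) ^ i * real (r choose Suc i) * g (Suc i))" .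
  have "(\<Sum>i\<le>Suc r. (-1) ^ i * real (Suc r choose i) * g i)
      = g 0 + (\<Sum>i\<le>r. - ((-1) ^ i * real (r choose Suc i) * g (Suc i)) - (-1) ^ i * real (r choose i) * g (Suc i))"
    by (subst sum.atMost_Suc_shift) (auto intro!: sum.cong simp: algebra_simps)
  then have "(\<Sum>i\<le>Suc r. (-1) ^ i * real (Suc r choose i) * g i)
      = (\<Sum>i\<le>r. (-1) ^ i * real (r choose i) * g i) - (\<Sum>i\<le>r. (-1) ^ i * real (r choose i) * g (Suc i))"
    unfolding row sum_subtractf sum_negf by simp
  then show ?thesis
    unfolding fin_diff_def atLeast0AtMost shift g_def[symmetric] .
qed

lemma uniform_norm_ge:
  assumes "\<And>x. \<bar>f x\<bar> \<le> B"
  shows "\<bar>f x\<bar> \<le> uniform_norm f"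
  unfolding uniform_norm_def using assms by (intro cSUP_upper bdd_aboveI[of _ B]) auto

lemma uniform_norm_le:
  assumes "\<And>x. \<bar>f x\<bar> \<le> B"
  shows "uniform_norm f \<le> B"
  unfolding uniform_norm_def using assms by (intro cSUP_least) auto

text \<open>Boundedness of \<open>f\<close> makes both suprema in the modulus of smoothness genuine.\<close>

lemma fin_diff_le_mod_smooth:
  assumes "f \<in> C_per" "0 < t" "t \<le> \<delta>"
  shows "\<bar>fin_diff r t f x\<bar> \<le> mod_smooth r f \<delta>"
proof -
  obtain B where B: "\<And>x. \<bar>f x\<bar> \<le> B" using C_per_bounded[OF assms(1)] by blast
  have "\<bar>fin_diff r t f x\<bar> \<le> uniform_norm (fin_diff r t f)"
    using abs_fin_diff_le[of f, OF B] by (rule uniform_norm_ge)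
  also have "\<dots> \<le> mod_smooth r f \<delta>"
    unfolding mod_smooth_def using assms abs_fin_diff_le[of f, OF B]
    by (intro cSUP_upper bdd_aboveI[of _ "2 ^ r * B"]) (auto intro!: uniform_norm_le)
  finally show ?thesis .
qed

lemma trig_poly_bounded:
  assumes "\<tau> \<in> trig_polys m"
  obtains B where "\<And>x. \<bar>\<tau> x\<bar> \<le> B"
proof -
  obtain a b where ab: "\<And>x. \<tau> x = a 0 + (\<Sum>k = 1..m. a k * cos (real k * x) + b k * sin (real k * x))"
    using assms unfolding trig_polys_def by blast
  have "\<bar>\<tau> x\<bar> \<le> \<bar>a 0\<bar> + (\<Sum>k = 1..m. \<bar>a k\<bar> + \<bar>b k\<bar>)" for x
  proof -
    have "\<bar>a k * cos (real k * x) + b k * sin (real k * x)\<bar> \<le> \<bar>a k\<bar> + \<bar>b k\<bar>" for k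
      using abs_triangle_ineq[of "a k * cos (real k * x)" "b k * sin (real k * x)"]
        mult_left_mono[OF abs_cos_le_one[of "real k * x"], of "\<bar>a k\<bar>"]
        mult_left_mono[OF abs_sin_le_one[of "real k * x"], of "\<bar>b k\<bar>"]
      by (simp add: abs_mult)
    then have "\<bar>\<Sum>k = 1..m. a k * cos (real k * x) + b k * sin (real k * x)\<bar> \<le> (\<Sum>k = 1..m. \<bar>a k\<bar> + \<bar>b k\<bar>)"
      by (intro order_trans[OF sum_abs] sum_mono)
    then show ?thesis unfolding ab by linarith
  qed
  then show ?thesis by (rule that)
qed

lemma best_approx_le:
  assumes "f \<in> C_per" "\<tau> \<in> trig_polys m" "\<And>x. \<bar>f x - \<tau> x\<bar> \<le> B"
  shows "best_approx m f \<le> B"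
proof -
  obtain F where F: "\<And>x. \<bar>f x\<bar> \<le> F" using C_per_bounded[OF assms(1)] by blast
  have "uniform_norm (\<lambda>x. f x - \<sigma> x) \<ge> 0" if "\<sigma> \<in> trig_polys m" for \<sigma>
  proof -
    obtain S where S: "\<And>x. \<bar>\<sigma> x\<bar> \<le> S" using trig_poly_bounded[OF \<open>\<sigma> \<in> trig_polys m\<close>] by blast
    have "\<bar>f x - \<sigma> x\<bar> \<le> F + S" for x
      using F[of x] S[of x] by linarith
    from uniform_norm_ge[of "\<lambda>x. f x - \<sigma> x", OF this, of 0] show ?thesis by linarith
  qed
  then have "best_approx m f \<le> uniform_norm (\<lambda>x. f x - \<tau> x)"
    unfolding best_approx_def using assms(2) by (intro cINF_lower bdd_belowI[of _ 0]) auto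
  also have "\<dots> \<le> B" using assms(3) by (rule uniform_norm_le)
  finally show ?thesis .
qed

text \<open>Both sides of the estimate for trigonometric sums are stable under small uniform perturbations of
  \<open>f\<close>; the order of the difference is fixed here, so the factor \<open>2 ^ (2 * k)\<close> does no harm.\<close>

lemma jackson_even:
  assumes "\<alpha> > 1" "k \<ge> 1" "n \<ge> 1" "f \<in> C_per"
    and bound: "\<And>t x. 0 < t \<Longrightarrow> t \<le> \<alpha> * pi / real n \<Longrightarrow> \<bar>fin_diff (2 * k) t f x\<bar> \<le> B"
  shows "best_approx (n - 1) f \<le> jackson_const \<alpha> * (gamma_star (2 * k) * B)"
proof (rule field_le_epsilon)
  fix \<epsilon> :: real assume "\<epsilon> > 0"
  define C where "C = jackson_const \<alpha> * gamma_star (2 * k)"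
  have C: "C \<ge> 0" using jackson_const_nonneg[OF assms(1)] by (simp add: C_def gamma_star_def)
  define \<delta> where "\<delta> = \<epsilon> / (1 + C * 2 ^ (2 * k))"
  have pos: "1 + C * 2 ^ (2 * k) > 0" using C by (simp add: add_pos_nonneg)
  then have \<delta>: "\<delta> > 0" "\<delta> * (1 + C * 2 ^ (2 * k)) = \<epsilon>" using \<open>\<epsilon> > 0\<close> by (simp_all add: \<delta>_def)
  obtain N c where c: "\<And>x. \<bar>f x - trig_sum N c x\<bar> \<le> \<delta>"
    using C_per_trig_sum_dense[OF assms(4) \<delta>(1)] by blast
  have D: "\<bar>fin_diff (2 * k) t (trig_sum N c) x\<bar> \<le> B + 2 ^ (2 * k) * \<delta>" if "0 < t" "t \<le> \<alpha> * pi / real n" for t x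
    using bound[OF that, of x] abs_fin_diff_le[of "\<lambda>y. f y - trig_sum N c y" \<delta> "2 * k" t x, OF c]
    unfolding fin_diff_diff[symmetric] by linarith
  obtain J1 J2 J3 where "kernel_antiderivatives k J1 J2 J3" using kernel_antiderivatives_exist .
  then obtain \<tau> where \<tau>: "\<tau> \<in> trig_polys (n - 1)"
    "\<And>x. \<bar>trig_sum N c x - \<tau> x\<bar> \<le> jackson_const \<alpha> * (gamma_star (2 * k) * (B + 2 ^ (2 * k) * \<delta>))"
    using kernel_antiderivatives.trig_sum_jackson[OF _ assms(1-3) D] by blast
  have "jackson_const \<alpha> * (gamma_star (2 * k) * (B + 2 ^ (2 * k) * \<delta>)) + \<delta>
      = jackson_const \<alpha> * (gamma_star (2 * k) * B) + \<delta> * (1 + C * 2 ^ (2 * k))"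
    by (simp add: C_def algebra_simps)
  moreover have "\<bar>f x - \<tau> x\<bar> \<le> jackson_const \<alpha> * (gamma_star (2 * k) * (B + 2 ^ (2 * k) * \<delta>)) + \<delta>" for x
    using c[of x] \<tau>(2)[of x] by linarith
  ultimately show "best_approx (n - 1) f \<le> jackson_const \<alpha> * (gamma_star (2 * k) * B) + \<epsilon>"
    using best_approx_le[OF assms(4) \<tau>(1)] \<delta>(2) by simp
qed

text \<open>Passing from the odd order \<open>2 m + 1\<close> to \<open>2 m + 2\<close> at most doubles the differences, and the central
  binomial coefficient doubles as well. Odd orders thus reduce to even ones without loss.\<close>

lemma gamma_star_odd: "gamma_star (2 * m + 1) = 2 * gamma_star (2 * (m + 1))"
proof -
  have "(2 * m + 1) choose (m + 1) = (2 * m + 1) choose m"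
    by (subst binomial_symmetric) auto
  then have "2 * (m + 1) choose (m + 1) = 2 * ((2 * m + 1) choose m)"
    by simp
  then have "real (2 * (m + 1) choose (m + 1)) = 2 * real ((2 * m + 1) choose m)"
    by (metis of_nat_mult of_nat_numeral)
  moreover have "2 * (m + 1) div 2 = m + 1" "(2 * m + 1) div 2 = m" by simp_all
  ultimately show ?thesis by (simp only: gamma_star_def) simp
qed

theorem theorem2:
  fixes \<alpha> :: real
  assumes "\<alpha> > 1"
  shows "\<exists>c :: real. \<forall>r n :: nat. \<forall>f \<in> C_per. r \<ge> 1 \<longrightarrow> n \<ge> 1 \<longrightarrow>
           best_approx (n - 1) f \<le> c * gamma_star r * mod_smooth r f (\<alpha> * pi / real n)"
proof (intro exI allI ballI impI)
  fix r n :: nat and f assume f: "f \<in> C_per" and r: "r \<ge> 1" and n: "n \<ge> 1"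
  let ?\<omega> = "mod_smooth r f (\<alpha> * pi / real n)"
  have \<omega>: "\<bar>fin_diff r t f x\<bar> \<le> ?\<omega>" if "0 < t" "t \<le> \<alpha> * pi / real n" for t x
    using f that by (rule fin_diff_le_mod_smooth)
  show "best_approx (n - 1) f \<le> jackson_const \<alpha> * gamma_star r * ?\<omega>"
  proof (cases "even r")
    case True
    then obtain k where k: "r = 2 * k" by blast
    then have "best_approx (n - 1) f \<le> jackson_const \<alpha> * (gamma_star (2 * k) * ?\<omega>)"
      using assms r n f \<omega> by (intro jackson_even) auto
    then show ?thesis by (simp add: k mult.assoc)
  next
    case False
    then obtain m where m: "r = 2 * m + 1" by (rule oddE)
    have "\<bar>fin_diff (2 * (m + 1)) t f x\<bar> \<le> 2 * ?\<omega>" if "0 < t" "t \<le> \<alpha> * pi / real n" for t x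
    proof -
      have "fin_diff (2 * (m + 1)) t f x = fin_diff r t f x - fin_diff r t f (x + t)"
        using fin_diff_Suc[of r t f x] m by simp
      then show ?thesis using \<omega>[OF that, of x] \<omega>[OF that, of "x + t"] by linarith
    qed
    then have "best_approx (n - 1) f \<le> jackson_const \<alpha> * (gamma_star (2 * (m + 1)) * (2 * ?\<omega>))"
      using assms n f by (intro jackson_even) auto
    then show ?thesis unfolding m gamma_star_odd by (simp only: mult_ac)
  qed
qed

end
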